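(* Let $\mathcal H$ and $\mathcal G$ be real separable Hilbert spaces, let $\beta\in\,]0,+\infty[$, let $h\colon\mathcal H\to\mathbb R$ be a convex differentiable function with $\beta^{-1}$-Lipschitz continuous gradient, let $g\in\Gamma_0(\mathcal G)$, let $L\colon\mathcal H\to\mathcal G$ be a bounded linear operator, and let $V$ be a closed vector subspace of $\mathcal H$. Suppose that the set $\mathcal P_V$ of solutions of $$\underset{x\in V}{\text{minimize}}\;\; h(x)+g(Lx)$$ is nonempty. Define $$K(x,v)=h(x)+\iota_V(x)+\langle Lx\mid v\rangle-g^*(v),\qquad (x,v)\in\mathcal H\times\mathcal G.$$ Let $(\gamma_n)_{n\in\mathbb N}$ be a decreasing sequence of strictly positive real numbers, let $(\tau_n)_{n\in\mathbb N}$ be an increasing sequence of strictly positive real numbers, let $U$ be a self-adjoint positive definite bounded linear operator on $\mathcal G$, let $(r_n)_{n\in\mathbb N}$ be an $\mathcal H$-valued square integrable random process, let $x_0$ be a $V$-valued square integrable random variable, and let $v_0$ be a $\mathcal G$-valued square integrable random variable. For every $n\in\mathbb N$ set $$ \begin{aligned} p_n&=P_V\big(x_n-\gamma_n(L^*v_n+r_n)\big),\\ v_{n+1}&=\operatorname{prox}^{U^{-1}}_{(\tau_n/\gamma_n)g^*}\Big(v_n+\frac{\tau_n}{\gamma_n}ULp_n\Big),\\ x_{n+1}&=P_V\big(x_n-\gamma_n(L^*v_{n+1}+r_n)\big), \end{aligned} $$ and, for every $N\in\mathbb N$, $$\tilde x_N=\Big(\sum_{n=0}^N\gamma_n\Big)^{-1}\sum_{n=0}^N\gamma_nx_{n+1},\qquad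 \tilde v_N=\Big(\sum_{n=0}^N\gamma_n\Big)^{-1}\sum_{n=0}^N\gamma_nv_{n+1}.$$ Assume that, with $\mathcal F_n=\sigma\big((x_k,v_k)_{0\le k\le n}\big)$, the following hold: 1. $\gamma_0\in\,]0,\beta[$. 2. There exists $\tau\in\,]0,+\infty[$ such that $\sup_{n\in\mathbb N}\tau_n\le\tau$ and $(\tau U)^{-1}-LP_VL^*$ is positive semidefinite. 3. For every $n\in\mathbb N$, $\mathsf E[r_n\,|\,\mathcal F_n]=\nabla h(x_n)$. 4. $c_0=\sum_{n\in\mathbb N}\gamma_n^2\,\mathsf E[\|r_n-\nabla h(x_n)\|^2]<+\infty$. Let $x\in V$ and $v\in\operatorname{dom}g^*$, and set $$c(x,v)=\mathsf E\big[\|x_0-x\|^2+\gamma_0^2\|v_0-v\|^2_{(\tau_0U)^{-1}-LP_VL^*}\big]+2\big((\tau\gamma_0\|U\|)^{1/2}\|L\|^2+1\big)c_0.$$ Then, for every $N\in\mathbb N$, $$\mathsf E\big[K(\tilde x_N,v)-K(x,\tilde v_N)\big]\le\frac{c(x,v)}{2}\Big(\sum_{n=0}^N\gamma_n\Big)^{-1}.$$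
   Context: All random variables are defined on a probability space $(\Omega,\mathcal F,\mathsf P)$; Hilbert spaces carry their Borel $\sigma$-algebra; $\mathsf E[\cdot|\cdot]$ is conditional expectation and $\sigma(\cdot)$ is the generated $\sigma$-field. $\Gamma_0(\mathcal G)$ is the set of proper lower semicontinuous convex functions $\mathcal G\to\,]-\infty,+\infty]$; $g^*(v)=\sup_{y}(\langle v\mid y\rangle-g(y))$ is the conjugate; $\operatorname{dom}g^*=\{v: g^*(v)<+\infty\}$; $\iota_V$ is the indicator function of $V$ ($0$ on $V$, $+\infty$ elsewhere); $P_V$ is the orthogonal projection onto $V$. For a self-adjoint positive semidefinite operator $W$, $\|v\|_W^2=\langle Wv\mid v\rangle$. For $W$ self-adjoint strongly positive and $f\in\Gamma_0(\mathcal G)$, $\operatorname{prox}_f^W(x)=\operatorname{argmin}_{y}\big(f(y)+\frac12\|x-y\|_W^2\big)$. "Decreasing" and "increasing" are meant in the non-strict sense. $U$ positive definite means strongly positive: there is $\chi>0$ with $\langle Ux\mid x\rangle\ge\chi\|x\|^2$ for all $x$. *)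

theory Defs
  imports "HOL-Analysis.Analysis" "HOL-Probability.Probability"
begin

text \<open>Throughout, a real separable Hilbert space is a type of sort
  \<open>{real_inner, banach, second_countable_topology}\<close>, and an extended-real-valued function
  has type \<open>'a \<Rightarrow> ereal\<close>.\<close>

section \<open>Convex analysis\<close>

definition Gamma0 :: "('a::real_inner \<Rightarrow> ereal) set" where
  "Gamma0 = {f.
     (\<forall>x. f x \<noteq> -\<infinity>) \<and> (\<exists>x. f x < \<infinity>) \<and>
     (\<forall>x. f x \<le> Liminf (at x) f) \<and>
     (\<forall>x y. \<forall>t\<in>{0<..<1}. f ((1 - t) *\<^sub>R x + t *\<^sub>R y) \<le> ereal (1 - t) * f x + ereal t * f y)}"

definition conjugate :: "('a::real_inner \<Rightarrow> ereal) \<Rightarrow> 'a \<Rightarrow> ereal" where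
  "conjugate f v = (SUP y. ereal (y \<bullet> v) - f y)"

definition edom :: "('a \<Rightarrow> ereal) \<Rightarrow> 'a set" where
  "edom f = {x. f x < \<infinity>}"

definition set_ind :: "'a set \<Rightarrow> 'a \<Rightarrow> ereal" where
  "set_ind V x = (if x \<in> V then 0 else \<infinity>)"

definition gradient :: "('a::real_inner \<Rightarrow> real) \<Rightarrow> 'a \<Rightarrow> 'a" where
  "gradient h x = (THE D. GDERIV h x :> D)"

section \<open>Operators\<close>

text \<open>The library's \<open>closest_point\<close> is restricted to \<open>heine_borel\<close> spaces, i.e. to finite
  dimension.\<close>

definition orth_proj :: "'a::real_inner set \<Rightarrow> 'a \<Rightarrow> 'a" where
  "orth_proj V x = (THE p. p \<in> V \<and> (\<forall>y\<in>V. (x - p) \<bullet> y = 0))"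

definition self_adjoint :: "('a::real_inner \<Rightarrow> 'a) \<Rightarrow> bool" where
  "self_adjoint W \<longleftrightarrow> (\<forall>x y. W x \<bullet> y = x \<bullet> W y)"

definition pos_semidef :: "('a::real_inner \<Rightarrow> 'a) \<Rightarrow> bool" where
  "pos_semidef W \<longleftrightarrow> (\<forall>x. 0 \<le> W x \<bullet> x)"

definition pos_def :: "('a::real_inner \<Rightarrow> 'a) \<Rightarrow> bool" where
  "pos_def W \<longleftrightarrow> (\<exists>c>0. \<forall>x. c * (norm x)\<^sup>2 \<le> W x \<bullet> x)"

text \<open>The squared seminorm \<open>\<parallel>v\<parallel>\<^sub>W\<^sup>2\<close>.\<close>

definition wnorm2 :: "('a::real_inner \<Rightarrow> 'a) \<Rightarrow> 'a \<Rightarrow> real" where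
  "wnorm2 W v = W v \<bullet> v"

definition prox :: "('a::real_inner \<Rightarrow> 'a) \<Rightarrow> ('a \<Rightarrow> ereal) \<Rightarrow> 'a \<Rightarrow> 'a" where
  "prox W f x = (ARG_MIN (\<lambda>y. f y + ereal (wnorm2 W (x - y) / 2)) y. True)"

text \<open>The operator \<open>(tU)\<^sup>-\<^sup>1 - L P\<^sub>V L\<^sup>*\<close>; it is self-adjoint whenever \<open>U\<close> is self-adjoint and
  strongly positive, so \<open>pos_semidef\<close> need not impose this separately.\<close>

definition precond ::
  "('b::real_inner \<Rightarrow> 'b) \<Rightarrow> ('a::real_inner \<Rightarrow> 'b) \<Rightarrow> 'a set \<Rightarrow> real \<Rightarrow> 'b \<Rightarrow> 'b" where
  "precond U L V t y = inv (\<lambda>z. t *\<^sub>R U z) y - L (orth_proj V (adjoint L y))"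

section \<open>The minimization problem and its Lagrangian\<close>

definition primal_solutions ::
  "('a::real_inner \<Rightarrow> real) \<Rightarrow> ('b::real_inner \<Rightarrow> ereal) \<Rightarrow> ('a \<Rightarrow> 'b) \<Rightarrow> 'a set \<Rightarrow> 'a set" where
  "primal_solutions h g L V =
     {x. is_arg_min (\<lambda>x. ereal (h x) + g (L x)) (\<lambda>x. x \<in> V) x}"

definition lagr ::
  "('a::real_inner \<Rightarrow> real) \<Rightarrow> ('b::real_inner \<Rightarrow> ereal) \<Rightarrow> ('a \<Rightarrow> 'b) \<Rightarrow> 'a set
    \<Rightarrow> 'a \<Rightarrow> 'b \<Rightarrow> ereal" where
  "lagr h g L V x v = ereal (h x) + set_ind V x + ereal (L x \<bullet> v) - conjugate g v"

section \<open>Probability\<close>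

definition square_integrable ::
  "'w measure \<Rightarrow> ('w \<Rightarrow> 'a::{real_inner, banach, second_countable_topology}) \<Rightarrow> bool" where
  "square_integrable M X \<longleftrightarrow>
     X \<in> borel_measurable M \<and> integrable M (\<lambda>\<omega>. (norm (X \<omega>))\<^sup>2)"

definition gen_sigma ::
  "'w measure \<Rightarrow> (nat \<Rightarrow> 'w \<Rightarrow> 'c::topological_space) \<Rightarrow> nat \<Rightarrow> 'w measure" where
  "gen_sigma M Z n =
     sigma (space M) {Z k -` A \<inter> space M | k A. k \<le> n \<and> A \<in> sets borel}"

text \<open>\<open>Y\<close> is a version of the conditional expectation of the Hilbert-valued \<open>X\<close> given the
  sub-\<open>\<sigma>\<close>-algebra \<open>F\<close>; the library's conditional expectation is real-valued only.\<close>

definition is_cond_exp ::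
  "'w measure \<Rightarrow> 'w measure \<Rightarrow> ('w \<Rightarrow> 'a::{real_inner, banach, second_countable_topology})
    \<Rightarrow> ('w \<Rightarrow> 'a) \<Rightarrow> bool" where
  "is_cond_exp M F X Y \<longleftrightarrow>
     subalgebra M F \<and> integrable M X \<and> integrable M Y \<and> Y \<in> borel_measurable F \<and>
     (\<forall>A\<in>sets F. (LINT \<omega>:A|M. X \<omega>) = (LINT \<omega>:A|M. Y \<omega>))"

section \<open>Ergodic averages of the iterates\<close>

definition erg_avg :: "(nat \<Rightarrow> real) \<Rightarrow> (nat \<Rightarrow> 'w \<Rightarrow> 'a::real_vector) \<Rightarrow> nat \<Rightarrow> 'w \<Rightarrow> 'a" where
  "erg_avg \<gamma> y N \<omega> = inverse (\<Sum>n\<le>N. \<gamma> n) *\<^sub>R (\<Sum>n\<le>N. \<gamma> n *\<^sub>R y (Suc n) \<omega>)"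

end

theory Submission
  imports Defs
begin

text \<open>
  Let \<open>e\<^sub>n\<close> be the noise \<open>r\<^sub>n - \<nabla>h(x\<^sub>n)\<close>, let \<open>(x, v)\<close> be the comparison
  pair, and consider the energy
  \<open>\<Phi>\<^sub>n = \<parallel>x\<^sub>n - x\<parallel>\<^sup>2 + \<gamma>\<^sub>n\<^sup>2 \<parallel>v\<^sub>n - v\<parallel>\<^sup>2\<close>, where the second norm is the seminorm of
  \<open>(\<tau>\<^sub>nU)\<^sup>-\<^sup>1 - L P L\<^sup>*\<close>. Every trajectory satisfies (\<open>gap_decrease\<close>)
  \<open>2 \<gamma>\<^sub>n gap(x\<^sub>n\<^sub>+\<^sub>1, v\<^sub>n\<^sub>+\<^sub>1) \<le> \<Phi>\<^sub>n - \<Phi>\<^sub>n\<^sub>+\<^sub>1 - 2 \<gamma>\<^sub>n (e\<^sub>n \<bullet> (x\<^sub>n\<^sub>+\<^sub>1 - x))\<close>.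
  The energy telescopes and is nonnegative, because \<open>\<gamma>\<close> decreases, \<open>\<tau>\<close> increases and the bound on
  \<open>\<tau>\<close> makes all these metrics positive semidefinite. The gap is jointly convex, so the gap at the
  ergodic averages is at most the weighted mean of the gaps (\<open>gap_jensen\<close>).

  It remains to bound the expected noise term. The point \<open>x\<^sub>n\<^sub>+\<^sub>1\<close> depends on the noise, so it is
  compared with the point \<open>y\<close> that the same step produces from the exact gradient. This point is
  measurable with respect to the past, hence \<open>e\<^sub>n \<bullet> (y - x)\<close> has expectation zero
  (\<open>cond_exp_error_orthogonal\<close>). The difference satisfies
  \<open>e\<^sub>n \<bullet> (x\<^sub>n\<^sub>+\<^sub>1 - y) \<ge> - \<gamma>\<^sub>n \<parallel>e\<^sub>n\<parallel>\<^sup>2\<close> (\<open>noise_propagation\<close>): the noise also enters through the dual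
  iterate, but by firm nonexpansiveness of the proximity operator this contribution has the right
  sign. The total contribution of the noise is therefore at most \<open>2 \<Sum> \<gamma>\<^sub>n\<^sup>2 E \<parallel>e\<^sub>n\<parallel>\<^sup>2 \<le> 2 c\<^sub>0\<close>.

  The Hilbert space facts used on the way (Riesz representation, adjoints, projections, inverses of
  strongly positive operators, existence of proximal points) all come from one existence lemma for
  minimizers of a convex function plus a coercive quadratic form
  (\<open>coercive_quadratic_attains_min\<close>). Only the conjugate of \<open>g\<close> occurs in the iteration and in the
  gap; it is a supremum of affine functions, which provides its convexity, its lower semicontinuity
  and an affine minorant.
\<close>

section \<open>Minimizing a convex function plus a coercive quadratic form\<close>

lemma quadratic_form_midpoint:
  fixes W :: "'a::real_inner \<Rightarrow> 'a"
  assumes "linear W" "self_adjoint W"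
  shows "W ((1/2) *\<^sub>R x + (1/2) *\<^sub>R y) \<bullet> ((1/2) *\<^sub>R x + (1/2) *\<^sub>R y)
    = (W x \<bullet> x + W y \<bullet> y) / 2 - W (x - y) \<bullet> (x - y) / 4"
proof -
  have "W y \<bullet> x = W x \<bullet> y"
    using assms(2) by (metis inner_commute self_adjoint_def)
  then show ?thesis
    by (simp add: linear_add[OF assms(1)] linear_diff[OF assms(1)] linear_scale[OF assms(1)]
        inner_add inner_diff field_simps)
qed

text \<open>The quadratic form makes the objective strongly convex: at the midpoint of two near-minimizers
  the objective drops by a multiple of their squared distance, so a minimizing sequence is Cauchy.
  This is the single existence
  result behind Riesz representation, orthogonal projection, the inverse of a strongly positive
  operator and the proximity operator. Closed sublevel sets inside \<open>S\<close> express lower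
  semicontinuity of the function that equals \<open>\<phi>\<close> on \<open>S\<close> and \<open>+\<infinity>\<close> elsewhere.\<close>

lemma coercive_quadratic_attains_min:
  fixes W :: "'a::{real_inner, banach} \<Rightarrow> 'a" and l \<phi> :: "'a \<Rightarrow> real"
  assumes W: "bounded_linear W" "self_adjoint W" "pos_def W" and l: "bounded_linear l"
    and cvx: "convex_on S \<phi>" and ne: "S \<noteq> {}"
    and lsc: "\<And>a. closed {y \<in> S. \<phi> y \<le> a}"
    and minorant: "\<And>y. y \<in> S \<Longrightarrow> \<alpha> - K * norm y \<le> \<phi> y"
  obtains p where "p \<in> S" "\<And>y. y \<in> S \<Longrightarrow> \<phi> p + W p \<bullet> p / 2 - l p \<le> \<phi> y + W y \<bullet> y / 2 - l y"
proof -
  interpret W: bounded_linear W by fact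
  interpret l: bounded_linear l by fact
  define q where "q y = W y \<bullet> y / 2 - l y" for y
  define J where "J y = \<phi> y + q y" for y
  obtain c where c: "c > 0" "\<And>x. c * (norm x)\<^sup>2 \<le> W x \<bullet> x"
    using W(3) unfolding pos_def_def by blast
  obtain K' where K': "\<And>x. norm (l x) \<le> norm x * K'" using l.bounded by blast
  have q_cont: "continuous_on UNIV q"
    unfolding q_def by (intro continuous_intros W.continuous_on l.continuous_on) simp
  \<comment> \<open>The quadratic growth beats the linear terms; completing the square gives the bound.\<close>
  have below: "\<alpha> - (K + K')\<^sup>2 / (2 * c) \<le> J y" if "y \<in> S" for y
  proof -
    have 1: "\<alpha> - (K + K') * norm y + c * (norm y)\<^sup>2 / 2 \<le> J y"
      using minorant[OF that] c(2)[of y] K'[of y] unfolding J_def q_def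
      by (simp add: field_simps)
    have "0 \<le> (c * norm y - (K + K'))\<^sup>2 / (2 * c)" using c by simp
    also have "\<dots> = c * (norm y)\<^sup>2 / 2 - (K + K') * norm y + (K + K')\<^sup>2 / (2 * c)"
      using c(1) by (simp add: power2_eq_square field_simps)
    finally show ?thesis using 1 by simp
  qed
  then have bdd: "bdd_below (J ` S)" by (auto intro!: bdd_belowI)
  define m where "m = (INF y\<in>S. J y)"
  have m_le: "m \<le> J y" if "y \<in> S" for y
    unfolding m_def by (rule cINF_lower[OF bdd that])
  have "\<exists>y. y \<in> S \<and> J y < m + inverse (real (Suc k))" for k
    using cINF_less_iff[OF ne bdd, of "m + inverse (real (Suc k))"] unfolding m_def by auto
  then obtain y where y: "\<And>k. y k \<in> S" "\<And>k. J (y k) < m + inverse (real (Suc k))"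
    by metis
  have gap: "(c / 8) * (norm (y i - y j))\<^sup>2 \<le> (inverse (real (Suc i)) + inverse (real (Suc j))) / 2"
    for i j
  proof -
    let ?z = "(1/2) *\<^sub>R y i + (1/2) *\<^sub>R y j"
    have "?z \<in> S" using cvx y(1) unfolding convex_on_def
      by (auto intro!: convexD)
    then have "m \<le> J ?z" by (rule m_le)
    moreover have "\<phi> ?z \<le> \<phi> (y i) / 2 + \<phi> (y j) / 2"
      using convex_onD[OF cvx, of "1/2" "y i" "y j"] y(1) by simp
    moreover have "q ?z = (q (y i) + q (y j)) / 2 - W (y i - y j) \<bullet> (y i - y j) / 8"
      unfolding q_def quadratic_form_midpoint[OF W.linear_axioms W(2)]
      by (simp add: l.add l.scale field_simps)
    moreover have "C / 8 \<le> (ui + uj) / 2"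
      if "m \<le> fz + qz" "fz \<le> fi / 2 + fj / 2" "qz = (qi + qj) / 2 - Q / 8"
        "fi + qi < m + ui" "fj + qj < m + uj" "C \<le> Q"
      for C Q fi fj fz qi qj qz ui uj :: real
      using that by argo
    ultimately have "c * (norm (y i - y j))\<^sup>2 / 8
        \<le> (inverse (real (Suc i)) + inverse (real (Suc j))) / 2"
      using y(2)[of i] y(2)[of j] c(2)[of "y i - y j"] unfolding J_def by blast
    then show ?thesis by simp
  qed
  have "Cauchy y"
  proof (rule metric_CauchyI)
    fix e :: real assume "e > 0"
    then have "c / 8 * e\<^sup>2 > 0" using c(1) by simp
    then obtain n where n: "inverse (real (Suc n)) < c / 8 * e\<^sup>2"
      using reals_Archimedean by blast
    have "dist (y i) (y j) < e" if "i \<ge> n" "j \<ge> n" for i j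
    proof -
      have "inverse (real (Suc i)) \<le> inverse (real (Suc n))"
        "inverse (real (Suc j)) \<le> inverse (real (Suc n))"
        using that by (auto intro!: le_imp_inverse_le)
      then have "(c / 8) * (norm (y i - y j))\<^sup>2 < c / 8 * e\<^sup>2" using gap[of i j] n by argo
      then have "(norm (y i - y j))\<^sup>2 < e\<^sup>2" using c(1) by simp
      then show ?thesis using \<open>e > 0\<close> by (simp add: dist_norm power_less_imp_less_base)
    qed
    then show "\<exists>M. \<forall>m\<ge>M. \<forall>n\<ge>M. dist (y m) (y n) < e" by blast
  qed
  then obtain p where p: "y \<longlonglongrightarrow> p" using Cauchy_convergent_iff convergent_def by blast
  have qp: "(\<lambda>k. q (y k)) \<longlonglongrightarrow> q p"
    using q_cont p continuous_on_tendsto_compose[of UNIV q y p sequentially] by auto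
  \<comment> \<open>The quadratic part is continuous, so near the limit the values of \<open>\<phi>\<close> are almost
    \<open>m - q p\<close>, and closedness of that sublevel set carries this over to \<open>p\<close>.\<close>
  have sub: "p \<in> S \<and> \<phi> p \<le> m - q p + e" if "e > 0" for e
  proof -
    have "(\<lambda>k. m + inverse (real (Suc k)) - q (y k)) \<longlonglongrightarrow> m + 0 - q p"
      by (intro tendsto_intros qp LIMSEQ_inverse_real_of_nat)
    then have "\<forall>\<^sub>F k in sequentially. m + inverse (real (Suc k)) - q (y k) < m - q p + e"
      using that by (auto dest!: order_tendstoD(2)[of _ _ _ "m - q p + e"])
    then have "\<forall>\<^sub>F k in sequentially. y k \<in> {y \<in> S. \<phi> y \<le> m - q p + e}"
    proof eventually_elim
      case (elim k) then show ?case using y(1)[of k] y(2)[of k] unfolding J_def by simp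
    qed
    then have "p \<in> {y \<in> S. \<phi> y \<le> m - q p + e}"
      using Lim_in_closed_set[OF lsc _ _ p] by simp
    then show ?thesis by simp
  qed
  have "p \<in> S" using sub[of 1] by simp
  have "\<phi> p \<le> m - q p"
  proof (rule field_le_epsilon)
    show "\<phi> p \<le> m - q p + e" if "0 < e" for e using sub[OF that] by (rule conjunct2)
  qed
  then have "J p \<le> J y" if "y \<in> S" for y
    using m_le[OF that] unfolding J_def by linarith
  then have "\<phi> p + W p \<bullet> p / 2 - l p \<le> \<phi> y + W y \<bullet> y / 2 - l y" if "y \<in> S" for y
    using that unfolding J_def q_def add_diff_eq by blast
  with \<open>p \<in> S\<close> show ?thesis by (rule that)
qed

text \<open>First-order optimality: along the segment from \<open>p\<close> to \<open>y\<close> the quadratic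
  remainder is of second order in the step \<open>t\<close>, so it disappears after dividing by
  \<open>t\<close> and letting \<open>t\<close> tend to zero.\<close>

lemma quadratic_min_variational:
  fixes W :: "'a::real_inner \<Rightarrow> 'a" and l \<phi> :: "'a \<Rightarrow> real"
  assumes W: "linear W" "self_adjoint W" and l: "linear l"
    and cvx: "convex_on S \<phi>" and p: "p \<in> S"
    and min: "\<And>y. y \<in> S \<Longrightarrow> \<phi> p + W p \<bullet> p / 2 - l p \<le> \<phi> y + W y \<bullet> y / 2 - l y"
    and y: "y \<in> S"
  shows "\<phi> p + (l (y - p) - W p \<bullet> (y - p)) \<le> \<phi> y"
proof -
  let ?d = "y - p" and ?Q = "W (y - p) \<bullet> (y - p) / 2"
  have sym: "W ?d \<bullet> p = W p \<bullet> ?d"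
    using W(2) by (metis inner_commute self_adjoint_def)
  have expand: "W (p + t *\<^sub>R d) \<bullet> (p + t *\<^sub>R d) / 2
      = W p \<bullet> p / 2 + t * (W p \<bullet> d) + t\<^sup>2 * (W d \<bullet> d / 2)"
    if "W d \<bullet> p = W p \<bullet> d" for t d
    unfolding linear_add[OF W(1)] linear_scale[OF W(1)] inner_add_left inner_add_right
      inner_scaleR_left inner_scaleR_right that
    by (simp add: power2_eq_square field_simps)
  have *: "l ?d - W p \<bullet> ?d - (\<phi> y - \<phi> p) \<le> t * ?Q" if t: "0 < t" "t < 1" for t
  proof -
    let ?z = "(1 - t) *\<^sub>R p + t *\<^sub>R y"
    have z: "?z = p + t *\<^sub>R ?d" by (simp add: algebra_simps)
    have "?z \<in> S" using cvx p y t unfolding convex_on_def by (auto intro!: convexD)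
    note min[OF this]
    moreover have "\<phi> ?z \<le> (1 - t) * \<phi> p + t * \<phi> y"
      using convex_onD[OF cvx, of t p y] p y t by simp
    moreover have "W ?z \<bullet> ?z / 2 = W p \<bullet> p / 2 + t * (W p \<bullet> ?d) + t\<^sup>2 * ?Q"
      unfolding z by (rule expand[OF sym])
    moreover have "l ?z = l p + t * l ?d"
      unfolding z linear_add[OF l] linear_scale[OF l] by simp
    ultimately have "\<phi> p \<le> (1 - t) * \<phi> p + t * \<phi> y + t * (W p \<bullet> ?d) + t\<^sup>2 * ?Q - t * l ?d"
      by linarith
    moreover have "t * (b - a - (fy - fp)) \<le> t * (t * Q)"
      if "fp \<le> (1 - t) * fp + t * fy + t * a + t\<^sup>2 * Q - t * b" for a b fp fy Q
      using that by (simp add: algebra_simps power2_eq_square)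
    ultimately have "t * (l ?d - W p \<bullet> ?d - (\<phi> y - \<phi> p)) \<le> t * (t * ?Q)"
      by blast
    then show ?thesis using t by (simp only: mult_le_cancel_left_pos)
  qed
  have "((\<lambda>t. t * ?Q) \<longlongrightarrow> 0 * ?Q) (at_right 0)" by (intro tendsto_intros)
  moreover have "\<forall>\<^sub>F t in at_right (0::real). l ?d - W p \<bullet> ?d - (\<phi> y - \<phi> p) \<le> t * ?Q"
    using * by (auto simp: eventually_at_right[of 0 1] intro!: exI[of _ 1])
  ultimately have "l ?d - W p \<bullet> ?d - (\<phi> y - \<phi> p) \<le> 0 * ?Q"
    by (intro tendsto_lowerbound) auto
  then show ?thesis by simp
qed

section \<open>Riesz representation, projections and inverse operators\<close>

text \<open>The Lax--Milgram theorem for a symmetric form, by minimization. On a subspace the variational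
  inequality can be applied to \<open>y\<close> and to \<open>-y\<close>, which turns it into an
  equation.\<close>

lemma coercive_variational_solution:
  fixes W :: "'a::{real_inner, banach} \<Rightarrow> 'a" and l :: "'a \<Rightarrow> real"
  assumes W: "bounded_linear W" "self_adjoint W" "pos_def W" and l: "bounded_linear l"
    and S: "subspace S" "closed S"
  obtains p where "p \<in> S" "\<And>y. y \<in> S \<Longrightarrow> l y = W p \<bullet> y"
proof -
  have cvx: "convex_on S (\<lambda>_. 0)"
    using subspace_imp_convex[OF S(1)] by (simp add: convex_on_def)
  have cl: "closed {y \<in> S. (0::real) \<le> a}" for a
    using S(2) by (cases "0 \<le> a") auto
  obtain p where p: "p \<in> S" "\<And>y. y \<in> S \<Longrightarrow> 0 + W p \<bullet> p / 2 - l p \<le> 0 + W y \<bullet> y / 2 - l y"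
    using coercive_quadratic_attains_min[OF W l cvx _ cl, of 0 0] subspace_0[OF S(1)] by auto
  have le: "l y \<le> W p \<bullet> y" if "y \<in> S" for y
  proof -
    have "p + y \<in> S" using S(1) p(1) that by (rule subspace_add)
    from quadratic_min_variational[OF bounded_linear.linear[OF W(1)] W(2)
        bounded_linear.linear[OF l] cvx p this]
    show ?thesis by simp
  qed
  have "l y = W p \<bullet> y" if "y \<in> S" for y
    using le[OF that] le[OF subspace_neg[OF S(1) that]] linear_neg[OF bounded_linear.linear[OF l]]
    by simp
  with p(1) that show ?thesis by blast
qed

lemma coercive_identity:
  "bounded_linear (\<lambda>x::'a::real_inner. x)" "self_adjoint (\<lambda>x::'a. x)" "pos_def (\<lambda>x::'a. x)"
  by (auto simp: self_adjoint_def pos_def_def dot_square_norm intro!: exI[of _ 1])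

lemma riesz_representation:
  fixes l :: "'a::{real_inner, banach} \<Rightarrow> real"
  assumes "bounded_linear l"
  obtains d where "\<And>y. l y = y \<bullet> d"
  using coercive_variational_solution[OF coercive_identity assms subspace_UNIV closed_UNIV]
  by (metis UNIV_I inner_commute)

lemma adjoint_inner:
  fixes L :: "'a::{real_inner, banach} \<Rightarrow> 'b::real_inner"
  assumes "bounded_linear L"
  shows "L x \<bullet> y = x \<bullet> adjoint L y"
proof -
  have "\<exists>f. \<forall>y x. L x \<bullet> y = x \<bullet> f y"
  proof (rule choice, rule allI)
    fix y
    have "bounded_linear (\<lambda>x. L x \<bullet> y)"
      by (intro bounded_linear_inner_left_comp assms)
    then show "\<exists>d. \<forall>x. L x \<bullet> y = x \<bullet> d" by (metis riesz_representation)
  qed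
  then have "\<exists>f. \<forall>x y. L x \<bullet> y = x \<bullet> f y" by blast
  then have "\<forall>x y. L x \<bullet> y = x \<bullet> adjoint L y"
    unfolding adjoint_def by (rule someI_ex)
  then show ?thesis by blast
qed

lemma eq_if_inner_eq: "(\<And>x. x \<bullet> a = x \<bullet> b) \<Longrightarrow> a = (b :: 'a::real_inner)"
  using vector_eq_ldot by blast

lemma bounded_linear_adjoint:
  fixes L :: "'a::{real_inner, banach} \<Rightarrow> 'b::real_inner"
  assumes L: "bounded_linear L"
  shows "bounded_linear (adjoint L)"
proof -
  note adj = adjoint_inner[OF L, symmetric]
  obtain K where K: "K > 0" "\<And>x. norm (L x) \<le> norm x * K"
    using bounded_linear.pos_bounded[OF L] by blast
  show ?thesis
  proof (rule bounded_linear_intro[where K = K])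
    fix x y :: 'b and c :: real
    show "adjoint L (x + y) = adjoint L x + adjoint L y"
      by (rule eq_if_inner_eq) (simp add: adj inner_add_right)
    show "adjoint L (c *\<^sub>R x) = c *\<^sub>R adjoint L x"
      by (rule eq_if_inner_eq) (simp add: adj)
    have "(norm (adjoint L x))\<^sup>2 = L (adjoint L x) \<bullet> x"
      by (simp add: power2_norm_eq_inner adj)
    also have "\<dots> \<le> norm (L (adjoint L x)) * norm x" by (rule norm_cauchy_schwarz)
    also have "\<dots> \<le> (norm (adjoint L x) * K) * norm x" by (intro mult_right_mono K) auto
    finally have "norm (adjoint L x) * norm (adjoint L x) \<le> norm (adjoint L x) * (norm x * K)"
      by (simp add: power2_eq_square mult_ac)
    then show "norm (adjoint L x) \<le> norm x * K"
      using K(1) by (cases "adjoint L x = 0") auto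
  qed
qed

text \<open>These two properties single out one point, so they pass to the definite description that
  defines \<open>orth_proj\<close>.\<close>

lemma orth_proj_characterization:
  fixes V :: "'a::{real_inner, banach} set"
  assumes V: "subspace V" "closed V"
  shows "orth_proj V x \<in> V" "y \<in> V \<Longrightarrow> (x - orth_proj V x) \<bullet> y = 0"
proof -
  obtain p where p: "p \<in> V" "\<And>y. y \<in> V \<Longrightarrow> x \<bullet> y = p \<bullet> y"
    using coercive_variational_solution[OF coercive_identity bounded_linear_inner_right V, of x]
    by blast
  have "orth_proj V x \<in> V \<and> (\<forall>y\<in>V. (x - orth_proj V x) \<bullet> y = 0)"
    unfolding orth_proj_def
  proof (rule theI[of _ p])
    show "p \<in> V \<and> (\<forall>y\<in>V. (x - p) \<bullet> y = 0)" using p by (simp add: inner_diff_left)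
  next
    fix q assume q: "q \<in> V \<and> (\<forall>y\<in>V. (x - q) \<bullet> y = 0)"
    have "(q - p) \<bullet> (q - p) = (x - p) \<bullet> (q - p) - (x - q) \<bullet> (q - p)"
      by (simp add: inner_diff_left)
    also have "\<dots> = 0"
      using q p subspace_diff[OF V(1), of q p] by (simp add: inner_diff_left)
    finally show "q = p" by simp
  qed
  then show "orth_proj V x \<in> V" "y \<in> V \<Longrightarrow> (x - orth_proj V x) \<bullet> y = 0" by auto
qed

lemma orth_proj_eqI:
  fixes V :: "'a::{real_inner, banach} set"
  assumes V: "subspace V" "closed V" and p: "p \<in> V" "\<And>y. y \<in> V \<Longrightarrow> (x - p) \<bullet> y = 0"
  shows "orth_proj V x = p"
proof -
  let ?q = "orth_proj V x"
  have "?q - p \<in> V" by (rule subspace_diff[OF V(1) orth_proj_characterization(1)[OF V] p(1)])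
  then have "(x - p) \<bullet> (?q - p) = 0" "(x - ?q) \<bullet> (?q - p) = 0"
    using p(2) orth_proj_characterization(2)[OF V] by auto
  then have "(?q - p) \<bullet> (?q - p) = 0" by (simp add: inner_diff)
  then show ?thesis by simp
qed

lemma bounded_linear_orth_proj:
  fixes V :: "'a::{real_inner, banach} set"
  assumes V: "subspace V" "closed V"
  shows "bounded_linear (orth_proj V)"
proof (rule bounded_linear_intro[where K = 1])
  note P = orth_proj_characterization[OF V]
  fix x y :: 'a and c :: real
  show "orth_proj V (x + y) = orth_proj V x + orth_proj V y"
  proof (rule orth_proj_eqI[OF V])
    show "orth_proj V x + orth_proj V y \<in> V" by (intro subspace_add V P)
    fix z assume "z \<in> V"
    then show "(x + y - (orth_proj V x + orth_proj V y)) \<bullet> z = 0"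
      using P(2)[of z x] P(2)[of z y] by (simp add: inner_diff_left inner_add_left)
  qed
  show "orth_proj V (c *\<^sub>R x) = c *\<^sub>R orth_proj V x"
  proof (rule orth_proj_eqI[OF V])
    show "c *\<^sub>R orth_proj V x \<in> V" by (intro subspace_scale V P)
    fix z assume "z \<in> V"
    then show "(c *\<^sub>R x - c *\<^sub>R orth_proj V x) \<bullet> z = 0"
      using P(2)[of z x] by (simp add: inner_diff_left)
  qed
  have "orth_proj V x \<bullet> orth_proj V x = x \<bullet> orth_proj V x"
    using P(2)[OF P(1), of x] by (simp add: inner_diff_left)
  also have "\<dots> \<le> norm x * norm (orth_proj V x)" by (rule norm_cauchy_schwarz)
  finally show "norm (orth_proj V x) \<le> norm x * 1"
    by (cases "orth_proj V x = 0") (auto simp: dot_square_norm power2_eq_square)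
qed

lemma orth_proj_inner:
  fixes V :: "'a::{real_inner, banach} set"
  assumes V: "subspace V" "closed V" and "y \<in> V"
  shows "orth_proj V x \<bullet> y = x \<bullet> y"
  using orth_proj_characterization(2)[OF V assms(3), of x] by (simp add: inner_diff_left)

lemma orth_proj_id:
  fixes V :: "'a::{real_inner, banach} set"
  assumes V: "subspace V" "closed V" and "y \<in> V"
  shows "orth_proj V y = y"
  by (rule orth_proj_eqI[OF assms]) simp

text \<open>Strong positivity bounds \<open>U\<close> from below, which gives injectivity and a bounded inverse;
  surjectivity is the solvability of the variational equation. The inverse is strongly positive
  because \<open>U\<close> is bounded.\<close>

lemma inverse_coercive:
  fixes U :: "'a::{real_inner, banach} \<Rightarrow> 'a"
  assumes U: "bounded_linear U" "self_adjoint U" "pos_def U"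
  shows "bij U" "bounded_linear (inv U)" "self_adjoint (inv U)" "pos_def (inv U)"
proof -
  interpret U: bounded_linear U by fact
  obtain c where c: "c > 0" "\<And>x. c * (norm x)\<^sup>2 \<le> U x \<bullet> x"
    using U(3) unfolding pos_def_def by blast
  obtain B where B: "B > 0" "\<And>x. norm (U x) \<le> norm x * B" using U.pos_bounded by blast
  have "inj U"
  proof (rule injI)
    fix x y assume "U x = U y"
    then have "U (x - y) = 0" by (simp add: U.diff)
    then have "c * (norm (x - y))\<^sup>2 \<le> 0" using c(2)[of "x - y"] by simp
    then show "x = y" using c(1) by (simp add: mult_le_0_iff)
  qed
  moreover have "surj U"
  proof -
    have "\<exists>x. y = U x" for y
    proof -
      obtain p where p: "\<And>z. y \<bullet> z = U p \<bullet> z"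
        using coercive_variational_solution[OF U bounded_linear_inner_right subspace_UNIV closed_UNIV]
        by (metis UNIV_I)
      have "y = U p"
      proof (rule eq_if_inner_eq)
        show "z \<bullet> y = z \<bullet> U p" for z using p[of z] by (subst (1 2) inner_commute)
      qed
      then show ?thesis by blast
      qed
    then show ?thesis by (simp add: surj_def)
  qed
  ultimately show bij: "bij U" by (simp add: bij_def)
  note iU = surj_f_inv_f[OF bij_is_surj[OF bij]]
  have inv_f: "inv U (U w) = w" for w by (simp add: inv_f_f[OF bij_is_inj[OF bij]])
  have bd: "norm (inv U x) \<le> norm x * (1 / c)" for x
  proof -
    have "c * (norm (inv U x))\<^sup>2 \<le> x \<bullet> inv U x" using c(2)[of "inv U x"] iU by simp
    also have "\<dots> \<le> norm x * norm (inv U x)" by (rule norm_cauchy_schwarz)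
    finally show ?thesis using c(1)
      by (cases "inv U x = 0") (auto simp: power2_eq_square field_simps)
  qed
  show "bounded_linear (inv U)"
  proof (rule bounded_linear_intro[OF _ _ bd])
    show "inv U (x + y) = inv U x + inv U y" for x y
      by (metis U.add iU inv_f)
    show "inv U (a *\<^sub>R x) = a *\<^sub>R inv U x" for a x
      by (metis U.scale iU inv_f)
  qed
  show "self_adjoint (inv U)" unfolding self_adjoint_def
    using U(2) by (metis iU self_adjoint_def)
  have "c / B\<^sup>2 * (norm x)\<^sup>2 \<le> inv U x \<bullet> x" for x
  proof -
    have "(norm x)\<^sup>2 \<le> (norm (inv U x) * B)\<^sup>2"
      using B(2)[of "inv U x"] iU by (intro power_mono) auto
    then have "c / B\<^sup>2 * (norm x)\<^sup>2 \<le> c * (norm (inv U x))\<^sup>2"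
      using B(1) c(1) by (simp add: field_simps)
    also have "\<dots> \<le> inv U x \<bullet> x"
      using c(2)[of "inv U x"] iU by (simp add: inner_commute)
    finally show ?thesis .
  qed
  then show "pos_def (inv U)" unfolding pos_def_def using c(1) B(1)
    by (intro exI[of _ "c / B\<^sup>2"]) simp
qed

section \<open>The conjugate and its scaled proximity operator\<close>

lemma Gamma0_finite_point:
  assumes "g \<in> Gamma0"
  obtains y b where "g y = ereal b"
proof -
  obtain y where "g y < \<infinity>" "g y \<noteq> -\<infinity>" using assms unfolding Gamma0_def by blast
  then show ?thesis using that[of y] by (cases "g y") auto
qed

lemma Gamma0_not_MInf: "g \<in> Gamma0 \<Longrightarrow> g y \<noteq> -\<infinity>"
  unfolding Gamma0_def by blast

lemma conjugate_ge: "g y = ereal b \<Longrightarrow> ereal (y \<bullet> v - b) \<le> conjugate g v"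
  unfolding conjugate_def by (rule SUP_upper2[of y]) auto

text \<open>Sublevel sets of the conjugate are intersections of half-spaces indexed by the points where
  \<open>g\<close> is finite; closedness, measurability and convexity of the conjugate are read off
  from this.\<close>

lemma conjugate_le_iff:
  assumes "g \<in> Gamma0"
  shows "conjugate g v \<le> ereal a \<longleftrightarrow> (\<forall>y b. g y = ereal b \<longrightarrow> y \<bullet> v - b \<le> a)"
proof
  assume "conjugate g v \<le> ereal a"
  then show "\<forall>y b. g y = ereal b \<longrightarrow> y \<bullet> v - b \<le> a"
    using conjugate_ge order_trans by (metis ereal_less_eq(3))
next
  assume *: "\<forall>y b. g y = ereal b \<longrightarrow> y \<bullet> v - b \<le> a"
  show "conjugate g v \<le> ereal a" unfolding conjugate_def
  proof (rule SUP_least)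
    fix y show "ereal (y \<bullet> v) - g y \<le> ereal a"
      using * Gamma0_not_MInf[OF assms, of y] by (cases "g y") auto
  qed
qed

lemma conjugate_not_MInf:
  assumes "g \<in> Gamma0"
  shows "conjugate g v \<noteq> -\<infinity>"
proof -
  obtain y b where "g y = ereal b" by (rule Gamma0_finite_point[OF assms])
  from conjugate_ge[of g, OF this, of v] show ?thesis by auto
qed

lemma conjugate_real:
  assumes "g \<in> Gamma0" "v \<in> edom (conjugate g)"
  shows "conjugate g v = ereal (real_of_ereal (conjugate g v))"
  using assms(2) conjugate_not_MInf[OF assms(1), of v] unfolding edom_def
  by (cases "conjugate g v") auto

lemma conjugate_affine_minorant:
  assumes "g \<in> Gamma0"
  obtains y b where "\<And>v. v \<in> edom (conjugate g) \<Longrightarrow> y \<bullet> v - b \<le> real_of_ereal (conjugate g v)"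
proof -
  obtain y b where "g y = ereal b" by (rule Gamma0_finite_point[OF assms])
  from conjugate_ge[of g, OF this] show ?thesis
    using conjugate_real[OF assms] by (intro that[of y b]) (metis ereal_less_eq(3))
qed

lemma closed_conjugate_sublevel:
  assumes "g \<in> Gamma0"
  shows "closed {v. conjugate g v \<le> ereal a}"
proof -
  have "{v. conjugate g v \<le> ereal a} = (\<Inter>(y, b)\<in>{(y, b). g y = ereal b}. {v. y \<bullet> v \<le> a + b})"
    using conjugate_le_iff[OF assms] by (auto simp: algebra_simps)
  then show ?thesis by (auto intro!: closed_INT closed_halfspace_le)
qed

lemma conjugate_borel_measurable:
  assumes "g \<in> Gamma0"
  shows "conjugate g \<in> borel_measurable borel"
  unfolding borel_measurable_iff_Iic_ereal
proof
  fix a :: ereal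
  have "closed {v. conjugate g v \<le> a}"
    using closed_conjugate_sublevel[OF assms] conjugate_not_MInf[OF assms] by (cases a) auto
  moreover have "conjugate g -` {..a} = {v. conjugate g v \<le> a}" by auto
  ultimately show "conjugate g -` {..a} \<inter> space borel \<in> sets borel" by simp
qed

lemma conjugate_convex_on:
  assumes "g \<in> Gamma0"
  shows "convex_on (edom (conjugate g)) (\<lambda>v. real_of_ereal (conjugate g v))"
proof -
  let ?\<phi> = "\<lambda>v. real_of_ereal (conjugate g v)"
  have *: "conjugate g (s *\<^sub>R v + t *\<^sub>R w) \<le> ereal (s * ?\<phi> v + t * ?\<phi> w)"
    if st: "0 \<le> s" "0 \<le> t" "s + t = 1"
      and vw: "v \<in> edom (conjugate g)" "w \<in> edom (conjugate g)" for s t v w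
    unfolding conjugate_le_iff[OF assms]
  proof (intro allI impI)
    fix y b assume gy: "g y = ereal b"
    have "y \<bullet> v - b \<le> ?\<phi> v" "y \<bullet> w - b \<le> ?\<phi> w"
      using conjugate_ge[of g, OF gy] conjugate_real[OF assms] vw by (metis ereal_less_eq(3))+
    then have "s * (y \<bullet> v - b) + t * (y \<bullet> w - b) \<le> s * ?\<phi> v + t * ?\<phi> w"
      using st by (intro add_mono mult_left_mono)
    moreover have "s * (y \<bullet> v - b) + t * (y \<bullet> w - b) = y \<bullet> (s *\<^sub>R v + t *\<^sub>R w) - (s + t) * b"
      by (simp add: inner_add_right algebra_simps)
    ultimately show "y \<bullet> (s *\<^sub>R v + t *\<^sub>R w) - b \<le> s * ?\<phi> v + t * ?\<phi> w"
      using st by simp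
  qed
  have dom: "s *\<^sub>R v + t *\<^sub>R w \<in> edom (conjugate g)"
    if "0 \<le> s" "0 \<le> t" "s + t = 1" "v \<in> edom (conjugate g)" "w \<in> edom (conjugate g)" for s t v w
    using *[OF that] unfolding edom_def by auto
  show ?thesis unfolding convex_on_def convex_def
  proof (intro conjI ballI allI impI)
    fix v w and s t :: real
    assume "v \<in> edom (conjugate g)" "w \<in> edom (conjugate g)" "0 \<le> s" "0 \<le> t" "s + t = 1"
    note st = this(3-5) this(1,2)
    show "s *\<^sub>R v + t *\<^sub>R w \<in> edom (conjugate g)" by (rule dom[OF st])
    show "?\<phi> (s *\<^sub>R v + t *\<^sub>R w) \<le> s * ?\<phi> v + t * ?\<phi> w"
      using *[OF st] conjugate_real[OF assms dom[OF st]] by (metis ereal_less_eq(3))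
  qed
qed

text \<open>The inequality says that \<open>W (z - q)\<close> is a subgradient at \<open>q\<close> of
  \<open>c\<close> times the conjugate. Since \<open>prox\<close> picks an arbitrary minimizer of an
  extended-real objective, the work lies in showing that minimizers exist and have finite value;
  then the objective is the one of the section on quadratic forms up to the constant
  \<open>W z \<bullet> z / 2\<close>.\<close>

lemma prox_conjugate_variational:
  fixes g :: "'b::{real_inner, banach} \<Rightarrow> ereal" and z :: 'b
  assumes g: "g \<in> Gamma0" and ne: "edom (conjugate g) \<noteq> {}"
    and W: "bounded_linear W" "self_adjoint W" "pos_def W" and c: "c > 0"
  defines "q \<equiv> prox W (\<lambda>y. ereal c * conjugate g y) z"
  shows "q \<in> edom (conjugate g)"
    and "v \<in> edom (conjugate g) \<Longrightarrow>
      c * real_of_ereal (conjugate g q) + W (z - q) \<bullet> (v - q) \<le> c * real_of_ereal (conjugate g v)"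
proof -
  let ?S = "edom (conjugate g)"
  let ?l = "\<lambda>y. W z \<bullet> y"
  define \<phi> where "\<phi> v = c * real_of_ereal (conjugate g v)" for v
  define F where "F y = ereal c * conjugate g y + ereal (wnorm2 W (z - y) / 2)" for y
  interpret W: bounded_linear W by fact
  have sym: "W y \<bullet> z = W z \<bullet> y" for y using W(2) by (metis inner_commute self_adjoint_def)
  have F: "F y = ereal (W z \<bullet> z / 2 + (\<phi> y + W y \<bullet> y / 2 - ?l y))" if "y \<in> ?S" for y
  proof -
    have "wnorm2 W (z - y) = W z \<bullet> z - 2 * ?l y + W y \<bullet> y"
      unfolding wnorm2_def W.diff inner_diff_left inner_diff_right sym[of y] by simp
    then show ?thesis unfolding F_def \<phi>_def
      by (subst conjugate_real[OF g that]) (simp add: field_simps)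
  qed
  have Finf: "F y = \<infinity>" if "y \<notin> ?S" for y
    using that c unfolding F_def edom_def by simp
  have cvx: "convex_on ?S \<phi>" unfolding \<phi>_def
    using c conjugate_convex_on[OF g] by (intro convex_on_cmul) auto
  have cl: "closed {y \<in> ?S. \<phi> y \<le> a}" for a
  proof -
    have "{y \<in> ?S. \<phi> y \<le> a} = {y. conjugate g y \<le> ereal (a / c)}"
    proof (intro Collect_cong iffI conjI)
      fix y assume "y \<in> ?S \<and> \<phi> y \<le> a"
      then show "conjugate g y \<le> ereal (a / c)"
        using conjugate_real[OF g, of y] c unfolding \<phi>_def
        by (metis ereal_less_eq(3) mult.commute pos_le_divide_eq)
    next
      fix y assume y: "conjugate g y \<le> ereal (a / c)"
      then show "y \<in> ?S" unfolding edom_def by auto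
      with y show "\<phi> y \<le> a"
        using conjugate_real[OF g, of y] c unfolding \<phi>_def
        by (metis ereal_less_eq(3) mult.commute pos_le_divide_eq)
    qed
    then show ?thesis using closed_conjugate_sublevel[OF g] by simp
  qed
  obtain y0 b0 where minor: "\<And>v. v \<in> ?S \<Longrightarrow> y0 \<bullet> v - b0 \<le> real_of_ereal (conjugate g v)"
    using conjugate_affine_minorant[OF g] by blast
  have min: "(- c * b0) - (c * norm y0) * norm v \<le> \<phi> v" if "v \<in> ?S" for v
  proof -
    have "- (norm y0 * norm v) \<le> y0 \<bullet> v"
      by (metis norm_cauchy_schwarz minus_le_iff inner_minus_left norm_minus_cancel)
    then have "- (norm y0 * norm v) - b0 \<le> real_of_ereal (conjugate g v)"
      using minor[OF that] by simp
    then have "c * (- (norm y0 * norm v) - b0) \<le> \<phi> v"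
      unfolding \<phi>_def using c by (intro mult_left_mono) auto
    then show ?thesis by (simp add: algebra_simps)
  qed
  obtain p where p: "p \<in> ?S"
      "\<And>y. y \<in> ?S \<Longrightarrow> \<phi> p + W p \<bullet> p / 2 - ?l p \<le> \<phi> y + W y \<bullet> y / 2 - ?l y"
    using coercive_quadratic_attains_min[OF W bounded_linear_inner_right cvx ne cl min, of "W z"]
    by blast
  have "is_arg_min F (\<lambda>_. True) p"
    unfolding is_arg_min_linorder
  proof (intro conjI TrueI allI impI)
    fix y show "F p \<le> F y"
      using F[OF p(1)] F[of y] Finf[of y] p(2)[of y] by (cases "y \<in> ?S") auto
  qed
  then have "is_arg_min F (\<lambda>_. True) q"
    unfolding q_def prox_def arg_min_def F_def by (rule someI)
  then have q: "F q \<le> F y" for y unfolding is_arg_min_linorder by simp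
  show qS: "q \<in> ?S"
    using q[of p] F[OF p(1)] Finf[of q] by (metis PInfty_neq_ereal(1) ereal_infty_less_eq(1))
  assume v: "v \<in> ?S"
  have "\<phi> q + (?l (v - q) - W q \<bullet> (v - q)) \<le> \<phi> v"
  proof (rule quadratic_min_variational[OF W.linear_axioms W(2) _ cvx qS _ v])
    show "linear ?l" by (intro bounded_linear.linear bounded_linear_inner_right)
    show "\<phi> q + W q \<bullet> q / 2 - ?l q \<le> \<phi> y + W y \<bullet> y / 2 - ?l y" if "y \<in> ?S" for y
      using q[of y] F[OF qS] F[OF that] by simp
  qed
  then show "c * real_of_ereal (conjugate g q) + W (z - q) \<bullet> (v - q)
      \<le> c * real_of_ereal (conjugate g v)"
    unfolding \<phi>_def by (simp add: W.diff inner_diff_left)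
qed

text \<open>Each of the two proximal points is tested in the variational inequality of the other, and the
  values of the conjugate cancel.\<close>

lemma prox_conjugate_firmly_nonexpansive:
  fixes g :: "'b::{real_inner, banach} \<Rightarrow> ereal"
  assumes g: "g \<in> Gamma0" and ne: "edom (conjugate g) \<noteq> {}"
    and W: "bounded_linear W" "self_adjoint W" "pos_def W" and c: "c > 0"
  defines "q \<equiv> prox W (\<lambda>y. ereal c * conjugate g y)"
  shows "W (q z - q z') \<bullet> (q z - q z') \<le> W (z - z') \<bullet> (q z - q z')"
proof -
  interpret W: bounded_linear W by fact
  note P = prox_conjugate_variational[OF g ne W c, folded q_def]
  have "W (z - q z) \<bullet> (q z' - q z) + W (z' - q z') \<bullet> (q z - q z') \<le> 0"
    using P(2)[of "q z'" z] P(2)[of "q z" z'] P(1) by (smt (verit))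
  then show ?thesis by (simp add: W.diff inner_diff algebra_simps)
qed

text \<open>Lipschitz continuity makes the iterates
  measurable and square integrable.\<close>

lemma prox_conjugate_lipschitz:
  fixes g :: "'b::{real_inner, banach} \<Rightarrow> ereal"
  assumes g: "g \<in> Gamma0" and ne: "edom (conjugate g) \<noteq> {}"
    and W: "bounded_linear W" "self_adjoint W" "pos_def W" and c: "c > 0"
  obtains K where "K-lipschitz_on UNIV (prox W (\<lambda>y. ereal c * conjugate g y))"
proof -
  let ?q = "prox W (\<lambda>y. ereal c * conjugate g y)"
  obtain m where m: "m > 0" "\<And>x. m * (norm x)\<^sup>2 \<le> W x \<bullet> x"
    using W(3) unfolding pos_def_def by blast
  obtain B where B: "B > 0" "\<And>x. norm (W x) \<le> norm x * B"
    using bounded_linear.pos_bounded[OF W(1)] by blast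
  have "norm (?q z - ?q z') \<le> B / m * norm (z - z')" for z z'
  proof -
    have "m * (norm (?q z - ?q z'))\<^sup>2 \<le> W (z - z') \<bullet> (?q z - ?q z')"
      using m(2) prox_conjugate_firmly_nonexpansive[OF assms] order_trans by blast
    also have "\<dots> \<le> norm (W (z - z')) * norm (?q z - ?q z')" by (rule norm_cauchy_schwarz)
    also have "\<dots> \<le> (norm (z - z') * B) * norm (?q z - ?q z')"
      by (intro mult_right_mono B) auto
    finally have "norm (?q z - ?q z') * (m * norm (?q z - ?q z'))
        \<le> norm (?q z - ?q z') * (B * norm (z - z'))"
      by (simp add: power2_eq_square mult_ac)
    then have "m * norm (?q z - ?q z') \<le> B * norm (z - z')"
      using B(1) by (cases "?q z = ?q z'") auto
    then show ?thesis using m(1) by (simp add: field_simps)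
  qed
  then show ?thesis using m(1) B(1)
    by (intro that[of "B / m"]) (auto simp: lipschitz_on_def dist_norm)
qed

section \<open>Smooth convex functions\<close>

lemma gradient_GDERIV:
  fixes h :: "'a::{real_inner, banach} \<Rightarrow> real"
  assumes "h differentiable (at y)"
  shows "GDERIV h y :> gradient h y"
proof -
  obtain D where D: "(h has_derivative D) (at y)" using assms unfolding differentiable_def by blast
  obtain d where "\<And>k. D k = k \<bullet> d" using riesz_representation has_derivative_bounded_linear[OF D] by blast
  then have "D = (\<lambda>k. k \<bullet> d)" by blast
  then have d: "GDERIV h y :> d" using D unfolding gderiv_def by simp
  show ?thesis unfolding gradient_def
  proof (rule theI[where a = d])
    fix e assume "GDERIV h y :> e"
    then have eq: "(\<lambda>k. k \<bullet> e) = (\<lambda>k. k \<bullet> d)"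
      using d unfolding gderiv_def by (rule has_derivative_unique)
    show "e = d" by (rule eq_if_inner_eq) (rule fun_cong[OF eq])
  qed (fact d)
qed

lemma line_derivative:
  fixes h :: "'a::{real_inner, banach} \<Rightarrow> real"
  assumes "\<forall>y. h differentiable (at y)"
  shows "((\<lambda>t. h (x + t *\<^sub>R d)) has_real_derivative gradient h (x + t *\<^sub>R d) \<bullet> d) (at t within A)"
proof -
  have "((\<lambda>t. h (x + t *\<^sub>R d)) has_derivative (\<lambda>s. (s *\<^sub>R d) \<bullet> gradient h (x + t *\<^sub>R d)))
      (at t within A)"
    by (rule has_derivative_compose[where g = h])
      (auto intro!: derivative_eq_intros gradient_GDERIV[unfolded gderiv_def] assms[rule_format])
  then show ?thesis
    unfolding has_field_derivative_def
    by (rule has_derivative_eq_rhs) (simp add: fun_eq_iff inner_commute)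
qed

lemma convex_above_gradient:
  fixes h :: "'a::{real_inner, banach} \<Rightarrow> real"
  assumes h: "convex_on UNIV h" "\<forall>y. h differentiable (at y)"
  shows "h x + gradient h x \<bullet> (y - x) \<le> h y"
proof -
  let ?f = "\<lambda>t::real. h (x + t *\<^sub>R (y - x))"
  have "convex_on UNIV ?f"
  proof (rule convex_onI)
    fix t a b :: real assume t: "0 < t" "t < 1"
    have "x + ((1 - t) *\<^sub>R a + t *\<^sub>R b) *\<^sub>R (y - x)
        = (1 - t) *\<^sub>R (x + a *\<^sub>R (y - x)) + t *\<^sub>R (x + b *\<^sub>R (y - x))"
      by (simp add: algebra_simps)
    then show "?f ((1 - t) *\<^sub>R a + t *\<^sub>R b) \<le> (1 - t) * ?f a + t * ?f b"
      using convex_onD[OF h(1), of t] t by simp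
  qed simp
  then have "?f 1 - ?f 0 \<ge> (gradient h (x + 0 *\<^sub>R (y - x)) \<bullet> (y - x)) * (1 - 0)"
    by (rule convex_on_imp_above_tangent) (auto intro!: line_derivative[OF h(2), of x "y - x" 0 UNIV, simplified])
  then show ?thesis by simp
qed

text \<open>The function \<open>f\<close> below compares \<open>h\<close> with its quadratic model along the
  segment; the Lipschitz condition on the gradient is exactly what makes it decreasing.\<close>

lemma descent_lemma:
  fixes h :: "'a::{real_inner, banach} \<Rightarrow> real"
  assumes h: "\<forall>y. h differentiable (at y)" and lip: "K-lipschitz_on UNIV (gradient h)"
  shows "h y \<le> h x + gradient h x \<bullet> (y - x) + K / 2 * (norm (y - x))\<^sup>2"
proof -
  let ?d = "y - x"
  define f where "f t = h (x + t *\<^sub>R ?d) - t * (gradient h x \<bullet> ?d) - K / 2 * t\<^sup>2 * (norm ?d)\<^sup>2" for t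
  have "f 1 \<le> f 0"
  proof (rule DERIV_nonpos_imp_nonincreasing[where f = f and a = 0 and b = 1])
    fix t :: real assume t: "0 \<le> t" "t \<le> 1"
    let ?D = "gradient h (x + t *\<^sub>R ?d) \<bullet> ?d - gradient h x \<bullet> ?d - K * t * (norm ?d)\<^sup>2"
    have "(f has_real_derivative ?D) (at t)" unfolding f_def
      by (auto intro!: derivative_eq_intros line_derivative[OF h])
    moreover have "?D \<le> 0"
    proof -
      have "(gradient h (x + t *\<^sub>R ?d) - gradient h x) \<bullet> ?d
          \<le> norm (gradient h (x + t *\<^sub>R ?d) - gradient h x) * norm ?d"
        by (rule norm_cauchy_schwarz)
      also have "\<dots> \<le> (K * norm (t *\<^sub>R ?d)) * norm ?d"
        using lipschitz_onD[OF lip, of "x + t *\<^sub>R ?d" x]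
        by (intro mult_right_mono) (auto simp: dist_norm)
      finally show ?thesis using t by (simp add: inner_diff_left power2_eq_square)
    qed
    ultimately show "\<exists>D. (f has_real_derivative D) (at t) \<and> D \<le> 0" by blast
  qed simp
  then show ?thesis unfolding f_def by simp
qed

section \<open>Square integrable random variables\<close>

lemma square_integrable_cong:
  assumes "\<And>\<omega>. \<omega> \<in> space M \<Longrightarrow> X \<omega> = Y \<omega>"
  shows "square_integrable M X \<longleftrightarrow> square_integrable M Y"
proof -
  have "X \<in> borel_measurable M \<longleftrightarrow> Y \<in> borel_measurable M"
    using assms by (rule measurable_cong)
  moreover have "integrable M (\<lambda>\<omega>. (norm (X \<omega>))\<^sup>2) \<longleftrightarrow> integrable M (\<lambda>\<omega>. (norm (Y \<omega>))\<^sup>2)"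
    by (rule Bochner_Integration.integrable_cong) (auto simp: assms)
  ultimately show ?thesis unfolding square_integrable_def by simp
qed

lemma square_integrable_add:
  assumes "square_integrable M X" "square_integrable M Y"
  shows "square_integrable M (\<lambda>\<omega>. X \<omega> + Y \<omega>)"
  unfolding square_integrable_def
proof
  note [measurable] = assms[unfolded square_integrable_def, THEN conjunct1]
  show "(\<lambda>\<omega>. X \<omega> + Y \<omega>) \<in> borel_measurable M" by measurable
  have "(norm (X \<omega> + Y \<omega>))\<^sup>2 \<le> 2 * (norm (X \<omega>))\<^sup>2 + 2 * (norm (Y \<omega>))\<^sup>2" for \<omega>
  proof -
    \<comment> \<open>Parallelogram law.\<close>
    have "(norm (X \<omega> + Y \<omega>))\<^sup>2 \<le> (norm (X \<omega> + Y \<omega>))\<^sup>2 + (norm (X \<omega> - Y \<omega>))\<^sup>2" by simp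
    also have "\<dots> = 2 * (norm (X \<omega>))\<^sup>2 + 2 * (norm (Y \<omega>))\<^sup>2"
      by (simp add: power2_norm_eq_inner inner_add inner_diff inner_commute)
    finally show ?thesis .
  qed
  moreover have "integrable M (\<lambda>\<omega>. 2 * (norm (X \<omega>))\<^sup>2 + 2 * (norm (Y \<omega>))\<^sup>2)"
    using assms unfolding square_integrable_def by auto
  ultimately show "integrable M (\<lambda>\<omega>. (norm (X \<omega> + Y \<omega>))\<^sup>2)"
    by (rule_tac Bochner_Integration.integrable_bound) auto
qed

lemma square_integrable_const:
  "finite_measure M \<Longrightarrow> square_integrable M (\<lambda>_. a)"
  unfolding square_integrable_def by (simp add: finite_measure.integrable_const)

lemma square_integrable_lipschitz:
  assumes M: "finite_measure M" and X: "square_integrable M X" and f: "K-lipschitz_on UNIV f"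
  shows "square_integrable M (\<lambda>\<omega>. f (X \<omega>))"
  unfolding square_integrable_def
proof
  note [measurable] = X[unfolded square_integrable_def, THEN conjunct1]
  have [measurable]: "f \<in> borel_measurable borel"
    by (intro borel_measurable_continuous_onI lipschitz_on_continuous_on[OF f])
  show "(\<lambda>\<omega>. f (X \<omega>)) \<in> borel_measurable M" by measurable
  have "(norm (f (X \<omega>)))\<^sup>2 \<le> 2 * (norm (f 0))\<^sup>2 + 2 * (K\<^sup>2 * (norm (X \<omega>))\<^sup>2)" for \<omega>
  proof -
    have "norm (f (X \<omega>)) \<le> norm (f (X \<omega>) - f 0) + norm (f 0)" by norm
    also have "\<dots> \<le> K * norm (X \<omega>) + norm (f 0)"
      using lipschitz_onD[OF f, of "X \<omega>" 0] by (simp add: dist_norm)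
    finally have "(norm (f (X \<omega>)))\<^sup>2 \<le> (K * norm (X \<omega>) + norm (f 0))\<^sup>2"
      by (intro power_mono) auto
    also have "\<dots> \<le> 2 * (norm (f 0))\<^sup>2 + 2 * (K * norm (X \<omega>))\<^sup>2"
      by (smt (verit) sum_squares_bound power2_sum mult.assoc)
    finally show ?thesis by (simp add: power_mult_distrib)
  qed
  moreover have "integrable M (\<lambda>\<omega>. 2 * (norm (f 0))\<^sup>2 + 2 * (K\<^sup>2 * (norm (X \<omega>))\<^sup>2))"
    using X M unfolding square_integrable_def by (auto intro: finite_measure.integrable_const)
  ultimately show "integrable M (\<lambda>\<omega>. (norm (f (X \<omega>)))\<^sup>2)"
    by (rule_tac Bochner_Integration.integrable_bound) auto
qed

lemma square_integrable_bounded_linear: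
  assumes "finite_measure M" "square_integrable M X" "bounded_linear T"
  shows "square_integrable M (\<lambda>\<omega>. T (X \<omega>))"
proof -
  interpret bounded_linear T by fact
  obtain K where "K > 0" "\<And>x. norm (T x) \<le> norm x * K" using pos_bounded by blast
  then have "K-lipschitz_on UNIV T"
    by (auto simp: lipschitz_on_def dist_norm diff[symmetric] mult.commute)
  then show ?thesis by (rule square_integrable_lipschitz[OF assms(1,2)])
qed

lemma square_integrable_scaleR:
  "finite_measure M \<Longrightarrow> square_integrable M X \<Longrightarrow> square_integrable M (\<lambda>\<omega>. a *\<^sub>R X \<omega>)"
  by (rule square_integrable_bounded_linear[OF _ _ bounded_linear_scaleR_right])

lemma square_integrable_diff:
  assumes "finite_measure M" "square_integrable M X" "square_integrable M Y"
  shows "square_integrable M (\<lambda>\<omega>. X \<omega> - Y \<omega>)"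
  using square_integrable_add[OF assms(2) square_integrable_scaleR[OF assms(1,3), of "-1"]] by simp

lemma square_integrable_sum:
  assumes "finite_measure M" "\<And>i. i \<in> I \<Longrightarrow> square_integrable M (X i)"
  shows "square_integrable M (\<lambda>\<omega>. \<Sum>i\<in>I. X i \<omega>)"
  using assms(2)
proof (induction I rule: infinite_finite_induct)
  case (insert i I)
  then show ?case by (simp add: square_integrable_add)
qed (use square_integrable_const[OF assms(1)] in simp_all)

lemma square_integrable_norm_product:
  assumes "square_integrable M X" "square_integrable M Y"
  shows "integrable M (\<lambda>\<omega>. norm (X \<omega>) * norm (Y \<omega>))"
proof -
  note [measurable] = assms[unfolded square_integrable_def, THEN conjunct1]
  have "norm (X \<omega>) * norm (Y \<omega>) \<le> (norm (X \<omega>))\<^sup>2 + (norm (Y \<omega>))\<^sup>2" for \<omega>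
    using sum_squares_bound[of "norm (X \<omega>)" "norm (Y \<omega>)"]
      mult_nonneg_nonneg[OF norm_ge_zero[of "X \<omega>"] norm_ge_zero[of "Y \<omega>"]] by linarith
  moreover have "integrable M (\<lambda>\<omega>. (norm (X \<omega>))\<^sup>2 + (norm (Y \<omega>))\<^sup>2)"
    using assms unfolding square_integrable_def by auto
  ultimately show ?thesis by (rule_tac Bochner_Integration.integrable_bound) auto
qed

lemma square_integrable_inner:
  assumes "square_integrable M X" "square_integrable M Y"
  shows "integrable M (\<lambda>\<omega>. X \<omega> \<bullet> Y \<omega>)"
proof -
  note [measurable] = assms[unfolded square_integrable_def, THEN conjunct1]
  show ?thesis
    by (rule Bochner_Integration.integrable_bound[OF square_integrable_norm_product[OF assms]])
      (auto simp: Cauchy_Schwarz_ineq2)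
qed

section \<open>Orthogonality of the noise to the past\<close>

text \<open>For simple \<open>Y\<close> this is the hypothesis on integrals over sets of \<open>F\<close>, taken
  level set by level set. The general case follows by dominated convergence with the majorant
  \<open>2 \<parallel>e\<parallel> \<parallel>Y\<parallel>\<close>.\<close>

lemma centered_orthogonal_to_measurable:
  fixes e Y :: "'w \<Rightarrow> 'a::{real_inner, banach, second_countable_topology}"
  assumes F: "subalgebra M F"
    and e: "integrable M e" "square_integrable M e"
    and centered: "\<And>A. A \<in> sets F \<Longrightarrow> (LINT \<omega>:A|M. e \<omega>) = 0"
    and Y: "Y \<in> borel_measurable F" "square_integrable M Y"
  shows "(LINT \<omega>|M. e \<omega> \<bullet> Y \<omega>) = 0"
proof -
  have sp: "space F = space M" and sub: "sets F \<subseteq> sets M"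
    using F unfolding subalgebra_def by auto
  note [measurable] = e(2)[unfolded square_integrable_def, THEN conjunct1]
    Y(2)[unfolded square_integrable_def, THEN conjunct1]
  obtain s where s: "\<And>i. simple_function F (s i)"
      "\<And>\<omega>. \<omega> \<in> space M \<Longrightarrow> (\<lambda>i. s i \<omega>) \<longlonglongrightarrow> Y \<omega>"
      "\<And>i \<omega>. \<omega> \<in> space M \<Longrightarrow> norm (s i \<omega>) \<le> 2 * norm (Y \<omega>)"
    using borel_measurable_implies_sequence_metric[OF Y(1), of 0] sp by (simp, metis)
  have s_meas[measurable]: "s i \<in> borel_measurable M" for i
    by (rule measurable_from_subalg[OF F borel_measurable_simple_function[OF s(1)]])
  have zero: "(LINT \<omega>|M. e \<omega> \<bullet> s i \<omega>) = 0" for i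
  proof -
    let ?A = "\<lambda>y. s i -` {y} \<inter> space M"
    have fin: "finite (s i ` space M)" and A: "\<And>y. y \<in> s i ` space M \<Longrightarrow> ?A y \<in> sets F"
      using s(1)[of i] sp unfolding simple_function_def by auto
    have int: "integrable M (\<lambda>\<omega>. indicator (?A y) \<omega> *\<^sub>R e \<omega>)" if "y \<in> s i ` space M" for y
      using A[OF that] sub e(1) by (intro integrable_mult_indicator) auto
    have "(LINT \<omega>|M. e \<omega> \<bullet> s i \<omega>)
        = (LINT \<omega>|M. (\<Sum>y\<in>s i ` space M. (indicator (?A y) \<omega> *\<^sub>R e \<omega>) \<bullet> y))"
    proof (rule Bochner_Integration.integral_cong[OF refl])
      fix \<omega> assume \<omega>: "\<omega> \<in> space M"
      have "(\<Sum>y\<in>s i ` space M. (indicator (?A y) \<omega> *\<^sub>R e \<omega>) \<bullet> y)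
          = (\<Sum>y\<in>s i ` space M. if s i \<omega> = y then e \<omega> \<bullet> y else 0)"
        by (rule sum.cong) (auto simp: \<omega> indicator_def)
      also have "\<dots> = e \<omega> \<bullet> s i \<omega>" using fin \<omega> by (simp add: sum.delta')
      finally show "e \<omega> \<bullet> s i \<omega> = (\<Sum>y\<in>s i ` space M. (indicator (?A y) \<omega> *\<^sub>R e \<omega>) \<bullet> y)" ..
    qed
    also have "\<dots> = (\<Sum>y\<in>s i ` space M. (LINT \<omega>|M. indicator (?A y) \<omega> *\<^sub>R e \<omega>) \<bullet> y)"
      using int by (simp add: Bochner_Integration.integral_sum del: inner_scaleR_left)
    also have "\<dots> = 0"
      using centered[OF A] unfolding set_lebesgue_integral_def by (intro sum.neutral) auto
    finally show ?thesis .
  qed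
  have "(\<lambda>i. LINT \<omega>|M. e \<omega> \<bullet> s i \<omega>) \<longlonglongrightarrow> (LINT \<omega>|M. e \<omega> \<bullet> Y \<omega>)"
  proof (rule integral_dominated_convergence[where w = "\<lambda>\<omega>. 2 * (norm (e \<omega>) * norm (Y \<omega>))"])
    show "integrable M (\<lambda>\<omega>. 2 * (norm (e \<omega>) * norm (Y \<omega>)))"
      using square_integrable_norm_product[OF e(2) Y(2)] by simp
    show "AE \<omega> in M. (\<lambda>i. e \<omega> \<bullet> s i \<omega>) \<longlonglongrightarrow> e \<omega> \<bullet> Y \<omega>"
      by (auto intro!: tendsto_intros s(2))
    show "AE \<omega> in M. norm (e \<omega> \<bullet> s i \<omega>) \<le> 2 * (norm (e \<omega>) * norm (Y \<omega>))" for i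
    proof (rule AE_I2)
      fix \<omega> assume "\<omega> \<in> space M"
      have "norm (e \<omega> \<bullet> s i \<omega>) \<le> norm (e \<omega>) * norm (s i \<omega>)"
        by (simp add: Cauchy_Schwarz_ineq2)
      also have "\<dots> \<le> norm (e \<omega>) * (2 * norm (Y \<omega>))"
        by (intro mult_left_mono s(3) \<open>\<omega> \<in> space M\<close>) auto
      finally show "norm (e \<omega> \<bullet> s i \<omega>) \<le> 2 * (norm (e \<omega>) * norm (Y \<omega>))" by simp
    qed
  qed measurable
  then show ?thesis unfolding zero using LIMSEQ_unique[OF tendsto_const] by metis
qed

text \<open>The preimage of an open \<open>S\<close> under one component is the preimage under the pair of the
  open cylinder over \<open>S\<close>.\<close>

lemma gen_sigma_component_measurable:
  fixes X :: "nat \<Rightarrow> 'w \<Rightarrow> 'a::topological_space" and Y :: "nat \<Rightarrow> 'w \<Rightarrow> 'b::topological_space"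
  shows "X n \<in> borel_measurable (gen_sigma M (\<lambda>k \<omega>. (X k \<omega>, Y k \<omega>)) n)"
    and "Y n \<in> borel_measurable (gen_sigma M (\<lambda>k \<omega>. (X k \<omega>, Y k \<omega>)) n)"
proof -
  let ?Z = "\<lambda>k \<omega>. (X k \<omega>, Y k \<omega>)"
  let ?E = "{?Z k -` A \<inter> space M | k A. k \<le> n \<and> A \<in> sets borel}"
  have E: "?E \<subseteq> Pow (space M)" by auto
  have gen: "space (gen_sigma M ?Z n) = space M" "\<And>B. B \<in> ?E \<Longrightarrow> B \<in> sets (gen_sigma M ?Z n)"
    unfolding gen_sigma_def by (rule space_measure_of[OF E], rule in_measure_of[OF E])
  show "X n \<in> borel_measurable (gen_sigma M ?Z n)"
  proof (rule borel_measurableI)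
    fix S :: "'a set" assume "open S"
    then have S: "?Z n -` (S \<times> UNIV) \<inter> space M \<in> ?E"
      by (auto intro!: exI[of _ n] exI[of _ "S \<times> UNIV"] borel_open open_Times)
    have "X n -` S \<inter> space M = ?Z n -` (S \<times> UNIV) \<inter> space M" by auto
    then show "X n -` S \<inter> space (gen_sigma M ?Z n) \<in> sets (gen_sigma M ?Z n)"
      unfolding gen(1) using gen(2)[OF S] by simp
  qed
  show "Y n \<in> borel_measurable (gen_sigma M ?Z n)"
  proof (rule borel_measurableI)
    fix S :: "'b set" assume "open S"
    then have S: "?Z n -` (UNIV \<times> S) \<inter> space M \<in> ?E"
      by (auto intro!: exI[of _ n] exI[of _ "UNIV \<times> S"] borel_open open_Times)
    have "Y n -` S \<inter> space M = ?Z n -` (UNIV \<times> S) \<inter> space M" by auto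
    then show "Y n -` S \<inter> space (gen_sigma M ?Z n) \<in> sets (gen_sigma M ?Z n)"
      unfolding gen(1) using gen(2)[OF S] by simp
  qed
qed

lemma cond_exp_error_orthogonal:
  fixes X Y Z :: "'w \<Rightarrow> 'a::{real_inner, banach, second_countable_topology}"
  assumes M: "finite_measure M" and ce: "is_cond_exp M F X Y"
    and sq: "square_integrable M X" "square_integrable M Y" "square_integrable M Z"
    and Z: "Z \<in> borel_measurable F"
  shows "(LINT \<omega>|M. (X \<omega> - Y \<omega>) \<bullet> Z \<omega>) = 0"
proof (rule centered_orthogonal_to_measurable)
  show "subalgebra M F" using ce unfolding is_cond_exp_def by simp
  show "integrable M (\<lambda>\<omega>. X \<omega> - Y \<omega>)" using ce unfolding is_cond_exp_def by simp
  show "square_integrable M (\<lambda>\<omega>. X \<omega> - Y \<omega>)" by (rule square_integrable_diff[OF M sq(1,2)])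
  fix A assume A: "A \<in> sets F"
  then have "A \<in> sets M" using ce unfolding is_cond_exp_def subalgebra_def by auto
  then have "set_integrable M A X" "set_integrable M A Y"
    using ce unfolding is_cond_exp_def set_integrable_def by (auto intro: integrable_mult_indicator)
  then show "(LINT \<omega>:A|M. X \<omega> - Y \<omega>) = 0"
    using ce A unfolding is_cond_exp_def by (simp add: set_integral_diff)
qed (fact Z sq(3))+

section \<open>One iteration of the primal-dual method\<close>

locale primal_dual =
  fixes h :: "'a::{real_inner, banach, second_countable_topology} \<Rightarrow> real"
    and g :: "'b::{real_inner, banach, second_countable_topology} \<Rightarrow> ereal"
    and L :: "'a \<Rightarrow> 'b" and V :: "'a set" and U :: "'b \<Rightarrow> 'b" and K :: real
  assumes h: "convex_on UNIV h" "\<forall>y. h differentiable (at y)" "K-lipschitz_on UNIV (gradient h)"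
    and g: "g \<in> Gamma0" "edom (conjugate g) \<noteq> {}"
    and L: "bounded_linear L"
    and V: "subspace V" "closed V"
    and U: "bounded_linear U" "self_adjoint U" "pos_def U"
begin

abbreviation P where "P \<equiv> orth_proj V"
abbreviation Ladj where "Ladj \<equiv> adjoint L"
abbreviation \<phi> where "\<phi> v \<equiv> real_of_ereal (conjugate g v)"
abbreviation form where "form t v \<equiv> wnorm2 (precond U L V t) v"

definition dual_prox where
  "dual_prox c = prox (inv U) (\<lambda>y. ereal c * conjugate g y)"

text \<open>The two steps are functions of the gradient sample \<open>s\<close>. This allows a comparison of
  the step that is actually taken with the one that uses the exact gradient, which depends on the
  past only.\<close>

definition dual_step where
  "dual_step \<gamma> \<tau> s x v = dual_prox (\<tau> / \<gamma>) (v + (\<tau> / \<gamma>) *\<^sub>R U (L (P (x - \<gamma> *\<^sub>R (Ladj v + s)))))"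

definition primal_step where
  "primal_step \<gamma> \<tau> s x v = P (x - \<gamma> *\<^sub>R (Ladj (dual_step \<gamma> \<tau> s x v) + s))"

text \<open>The difference of the two Lagrangian values in the theorem, at a point \<open>x\<close> of
  \<open>V\<close> and at a point \<open>v\<close> of the domain of the conjugate, relative to the
  comparison pair \<open>(z, w)\<close>.\<close>

definition gap where
  "gap z w x v = h x - h z + L x \<bullet> w - L z \<bullet> v - \<phi> w + \<phi> v"

sublocale L: bounded_linear L by (rule L)
sublocale Ladj: bounded_linear Ladj by (rule bounded_linear_adjoint[OF L])
sublocale P: bounded_linear P by (rule bounded_linear_orth_proj[OF V])
sublocale U: bounded_linear U by (rule U)
sublocale Ui: bounded_linear "inv U" by (rule inverse_coercive[OF U])

lemma inv_U_U: "inv U (U y) = y"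
  using inverse_coercive(1)[OF U] by (simp add: inv_f_f bij_is_inj)

lemma U_inv_U: "U (inv U y) = y"
  using inverse_coercive(1)[OF U] by (simp add: surj_f_inv_f bij_is_surj)

lemma P_inner: "P x \<bullet> y = P x \<bullet> P y" "x \<bullet> P y = P x \<bullet> P y"
  using orth_proj_inner[OF V orth_proj_characterization(1)[OF V]] by (metis inner_commute)+

lemma precond_eq:
  assumes "t > 0"
  shows "precond U L V t = (\<lambda>y. (1 / t) *\<^sub>R inv U y - L (P (Ladj y)))"
proof
  fix y
  have "inv (\<lambda>z. t *\<^sub>R U z) y = (1 / t) *\<^sub>R inv U y"
  proof (rule inv_f_eq)
    show "inj (\<lambda>z. t *\<^sub>R U z)"
      using assms inv_U_U by (auto intro!: injI) (metis)
    show "t *\<^sub>R U ((1 / t) *\<^sub>R inv U y) = y" using assms by (simp add: U.scale U_inv_U)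
  qed
  then show "precond U L V t y = (1 / t) *\<^sub>R inv U y - L (P (Ladj y))"
    unfolding precond_def by simp
qed

lemma bounded_linear_precond: "t > 0 \<Longrightarrow> bounded_linear (precond U L V t)"
  unfolding precond_eq
  by (intro bounded_linear_sub bounded_linear_compose[OF bounded_linear_scaleR_right]
      bounded_linear_compose[OF L] bounded_linear_compose[OF P.bounded_linear_axioms]
      Ui.bounded_linear_axioms Ladj.bounded_linear_axioms)

lemma form_eq:
  assumes "t > 0"
  shows "form t y = inv U y \<bullet> y / t - (norm (P (Ladj y)))\<^sup>2"
  unfolding wnorm2_def precond_eq[OF assms] inner_diff_left adjoint_inner[OF L]
    P_inner(1)[of "Ladj y" "Ladj y"]
  by (simp add: power2_norm_eq_inner)

lemma inv_U_nonneg: "0 \<le> inv U y \<bullet> y"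
proof -
  obtain c where "c > 0" "\<And>x. c * (norm x)\<^sup>2 \<le> inv U x \<bullet> x"
    using inverse_coercive(4)[OF U] unfolding pos_def_def by blast
  then show ?thesis by (meson less_imp_le mult_nonneg_nonneg order_trans zero_le_power2)
qed

lemma form_antimono:
  assumes "0 < s" "s \<le> t"
  shows "form t y \<le> form s y"
proof -
  have "inv U y \<bullet> y / t \<le> inv U y \<bullet> y / s"
    using assms inv_U_nonneg by (intro divide_left_mono) auto
  then show ?thesis using assms by (simp add: form_eq)
qed

lemma form_polarization:
  assumes "t > 0"
  shows "2 * (precond U L V t (a - b) \<bullet> (b - c)) = form t (a - c) - form t (b - c) - form t (a - b)"
proof -
  interpret W: bounded_linear "precond U L V t" by (rule bounded_linear_precond[OF assms])
  have sym: "precond U L V t y \<bullet> z = precond U L V t z \<bullet> y" for y z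
  proof -
    have "L (P (Ladj y)) \<bullet> z = L (P (Ladj z)) \<bullet> y"
      unfolding adjoint_inner[OF L] by (metis P_inner inner_commute)
    moreover have "inv U y \<bullet> z = inv U z \<bullet> y"
      using inverse_coercive(3)[OF U] by (metis inner_commute self_adjoint_def)
    ultimately show ?thesis unfolding precond_eq[OF assms] by (simp add: inner_diff_left)
  qed
  show ?thesis unfolding wnorm2_def W.diff inner_diff_left inner_diff_right
    using sym[of a b] sym[of a c] sym[of b c] by simp
qed

lemma lagr_difference:
  assumes "x \<in> V" "z \<in> V" "v \<in> edom (conjugate g)" "w \<in> edom (conjugate g)"
  shows "lagr h g L V x w - lagr h g L V z v = ereal (gap z w x v)"
proof -
  have "lagr h g L V x w = ereal (h x + L x \<bullet> w - \<phi> w)"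
    unfolding lagr_def set_ind_def using assms by (subst conjugate_real[OF g(1)]) auto
  moreover have "lagr h g L V z v = ereal (h z + L z \<bullet> v - \<phi> v)"
    unfolding lagr_def set_ind_def using assms by (subst conjugate_real[OF g(1)]) auto
  ultimately show ?thesis unfolding gap_def by simp
qed

lemma gap_jensen:
  assumes I: "finite I" "I \<noteq> {}" and a: "sum a I = 1" "\<And>i. i \<in> I \<Longrightarrow> 0 \<le> a i"
    and v: "\<And>i. i \<in> I \<Longrightarrow> v i \<in> edom (conjugate g)"
  shows "gap z w (\<Sum>i\<in>I. a i *\<^sub>R x i) (\<Sum>i\<in>I. a i *\<^sub>R v i) \<le> (\<Sum>i\<in>I. a i * gap z w (x i) (v i))"
proof -
  have "h (\<Sum>i\<in>I. a i *\<^sub>R x i) \<le> (\<Sum>i\<in>I. a i * h (x i))"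
    by (rule convex_on_sum[OF I h(1) a]) auto
  moreover have "\<phi> (\<Sum>i\<in>I. a i *\<^sub>R v i) \<le> (\<Sum>i\<in>I. a i * \<phi> (v i))"
    by (rule convex_on_sum[OF I conjugate_convex_on[OF g(1)] a v])
  moreover have "L (\<Sum>i\<in>I. a i *\<^sub>R x i) \<bullet> w = (\<Sum>i\<in>I. a i * (L (x i) \<bullet> w))"
    by (simp add: L.sum L.scale inner_sum_left)
  moreover have "L z \<bullet> (\<Sum>i\<in>I. a i *\<^sub>R v i) = (\<Sum>i\<in>I. a i * (L z \<bullet> v i))"
    by (simp add: inner_sum_right)
  moreover have "(\<Sum>i\<in>I. a i * gap z w (x i) (v i))
      = (\<Sum>i\<in>I. a i * h (x i)) - sum a I * h z + (\<Sum>i\<in>I. a i * (L (x i) \<bullet> w))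
        - (\<Sum>i\<in>I. a i * (L z \<bullet> v i)) - sum a I * \<phi> w + (\<Sum>i\<in>I. a i * \<phi> (v i))"
    unfolding gap_def ring_distribs sum.distrib sum_subtractf sum_distrib_right ..
  ultimately show ?thesis unfolding gap_def a(1) by linarith
qed

text \<open>Together with an integrable upper bound this makes the gap at random points integrable.
  The minorant adds the tangent of \<open>h\<close> at \<open>z\<close> to an affine minorant of the
  conjugate.\<close>

lemma gap_affine_minorant:
  obtains a b d where "\<And>x v. v \<in> edom (conjugate g) \<Longrightarrow> x \<bullet> a + v \<bullet> b + d \<le> gap z w x v"
proof -
  obtain y c where y: "\<And>v. v \<in> edom (conjugate g) \<Longrightarrow> y \<bullet> v - c \<le> \<phi> v"
    using conjugate_affine_minorant[OF g(1)] by blast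
  show ?thesis
  proof (rule that)
    fix x v assume v: "v \<in> edom (conjugate g)"
    show "x \<bullet> (gradient h z + Ladj w) + v \<bullet> (y - L z) + (- gradient h z \<bullet> z - \<phi> w - c)
        \<le> gap z w x v"
      using convex_above_gradient[OF h(1,2), of z x] y[OF v]
      unfolding gap_def adjoint_inner[OF L, of x w]
      by (simp add: inner_add_right inner_diff_right inner_commute algebra_simps)
  qed
qed

lemma gap_borel_measurable:
  assumes [measurable]: "X \<in> borel_measurable M" "Y \<in> borel_measurable M"
  shows "(\<lambda>\<omega>. gap z w (X \<omega>) (Y \<omega>)) \<in> borel_measurable M"
proof -
  have [measurable]: "h \<in> borel_measurable borel"
    using h(2) by (intro borel_measurable_continuous_onI continuous_at_imp_continuous_on)
      (auto intro: differentiable_imp_continuous_within)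
  have [measurable]: "L \<in> borel_measurable borel"
    by (intro borel_measurable_continuous_onI linear_continuous_on L)
  have [measurable]: "\<phi> \<in> borel_measurable borel"
    using conjugate_borel_measurable[OF g(1)] by measurable
  show ?thesis unfolding gap_def by measurable
qed

context
  fixes \<gamma> \<tau> :: real
  assumes pos: "\<gamma> > 0" "\<tau> > 0"
begin

lemma dual_prox_variational:
  shows "dual_prox (\<tau> / \<gamma>) z \<in> edom (conjugate g)"
    and "w \<in> edom (conjugate g) \<Longrightarrow>
      \<tau> / \<gamma> * \<phi> (dual_prox (\<tau> / \<gamma>) z)
        + inv U (z - dual_prox (\<tau> / \<gamma>) z) \<bullet> (w - dual_prox (\<tau> / \<gamma>) z) \<le> \<tau> / \<gamma> * \<phi> w"
proof -
  have c: "\<tau> / \<gamma> > 0" using pos by simp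
  note P = prox_conjugate_variational[OF g inverse_coercive(2-4)[OF U] c, folded dual_prox_def]
  show "dual_prox (\<tau> / \<gamma>) z \<in> edom (conjugate g)" by (rule P)
  show "\<tau> / \<gamma> * \<phi> (dual_prox (\<tau> / \<gamma>) z)
        + inv U (z - dual_prox (\<tau> / \<gamma>) z) \<bullet> (w - dual_prox (\<tau> / \<gamma>) z) \<le> \<tau> / \<gamma> * \<phi> w"
    if "w \<in> edom (conjugate g)" by (rule P(2)[OF that])
qed

lemma dual_step_in_edom: "dual_step \<gamma> \<tau> s x v \<in> edom (conjugate g)"
  unfolding dual_step_def by (rule dual_prox_variational)

lemma primal_step_in_V: "primal_step \<gamma> \<tau> s x v \<in> V"
  unfolding primal_step_def by (rule orth_proj_characterization(1)[OF V])

text \<open>Three estimates are added: the orthogonality relation of the projection, the descent lemma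
  combined with convexity of \<open>h\<close>, and the variational inequality of the proximal step.
  All bilinear terms in \<open>L\<close> cancel. The dual step uses \<open>L p\<close> instead of
  \<open>L x'\<close>, and the difference is \<open>\<gamma> L P L\<^sup>* (v' - v)\<close>; this is the term that
  the metric \<open>(\<tau>U)\<^sup>-\<^sup>1 - L P L\<^sup>*\<close> subtracts, so both combine into one quadratic form.\<close>

lemma gap_decrease:
  fixes s x z :: 'a and v w :: 'b
  assumes K: "K * \<gamma> \<le> 1" and W: "pos_semidef (precond U L V \<tau>)"
    and x: "x \<in> V" and z: "z \<in> V" and w: "w \<in> edom (conjugate g)"
  defines "x' \<equiv> primal_step \<gamma> \<tau> s x v" and "v' \<equiv> dual_step \<gamma> \<tau> s x v"
  shows "2 * \<gamma> * gap z w x' v'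
    \<le> (norm (x - z))\<^sup>2 - (norm (x' - z))\<^sup>2 + \<gamma>\<^sup>2 * (form \<tau> (v - w) - form \<tau> (v' - w))
      - 2 * \<gamma> * ((s - gradient h x) \<bullet> (x' - z))"
proof -
  define p where "p = P (x - \<gamma> *\<^sub>R (Ladj v + s))"
  have v': "v' = dual_prox (\<tau> / \<gamma>) (v + (\<tau> / \<gamma>) *\<^sub>R U (L p))"
    unfolding v'_def dual_step_def p_def ..
  have x': "x' = P (x - \<gamma> *\<^sub>R (Ladj v' + s))"
    unfolding x'_def v'_def primal_step_def ..
  have x'V: "x' \<in> V" unfolding x'_def by (rule primal_step_in_V)

  have primal: "2 * \<gamma> * ((Ladj v' + s) \<bullet> (x' - z))
      = (norm (x - z))\<^sup>2 - (norm (x' - z))\<^sup>2 - (norm (x - x'))\<^sup>2"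
  proof -
    have "x' - z \<in> V" by (rule subspace_diff[OF V(1) x'V z])
    then have "(x - \<gamma> *\<^sub>R (Ladj v' + s) - x') \<bullet> (x' - z) = 0"
      unfolding x' by (rule orth_proj_characterization(2)[OF V])
    then have "\<gamma> * ((Ladj v' + s) \<bullet> (x' - z)) = (x - x') \<bullet> (x' - z)"
      by (simp add: inner_diff_left)
    then show ?thesis
      by (simp add: power2_norm_eq_inner inner_diff inner_commute algebra_simps)
  qed

  have smooth: "2 * \<gamma> * (h x' - h z)
      \<le> 2 * \<gamma> * (gradient h x \<bullet> (x' - z)) + (norm (x - x'))\<^sup>2"
  proof -
    have "h x' - h z \<le> gradient h x \<bullet> (x' - x) - gradient h x \<bullet> (z - x)
        + K / 2 * (norm (x' - x))\<^sup>2"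
      using descent_lemma[OF h(2,3), of x' x] convex_above_gradient[OF h(1,2), of x z] by simp
    also have "gradient h x \<bullet> (x' - x) - gradient h x \<bullet> (z - x) = gradient h x \<bullet> (x' - z)"
      by (simp add: inner_diff_right)
    finally have "2 * \<gamma> * (h x' - h z)
        \<le> 2 * \<gamma> * (gradient h x \<bullet> (x' - z) + K / 2 * (norm (x' - x))\<^sup>2)"
      using pos by (intro mult_left_mono) auto
    also have "\<dots> = 2 * \<gamma> * (gradient h x \<bullet> (x' - z)) + (K * \<gamma>) * (norm (x' - x))\<^sup>2"
      by (simp add: algebra_simps)
    also have "\<dots> \<le> 2 * \<gamma> * (gradient h x \<bullet> (x' - z)) + 1 * (norm (x' - x))\<^sup>2"
      by (intro add_left_mono mult_right_mono K) auto
    finally show ?thesis by (simp add: norm_minus_commute)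
  qed

  have dual: "2 * \<gamma> * (\<phi> v' - \<phi> w) \<le> \<gamma>\<^sup>2 * (form \<tau> (v - w) - form \<tau> (v' - w))
      + 2 * \<gamma> * (L x' \<bullet> (v' - w))"
  proof -
    \<comment> \<open>\<open>p\<close> and \<open>x'\<close> project points that differ only in the dual variable.\<close>
    have "p = P (x' + \<gamma> *\<^sub>R P (Ladj (v' - v)))"
      unfolding p_def x' by (simp add: P.diff P.add P.scale Ladj.diff algebra_simps
          orth_proj_id[OF V] orth_proj_characterization(1)[OF V])
    also have "\<dots> = x' + \<gamma> *\<^sub>R P (Ladj (v' - v))"
      by (intro orth_proj_id[OF V] subspace_add[OF V(1)] subspace_scale[OF V(1)]
          orth_proj_characterization(1)[OF V] x'V)
    finally have Lp: "L p = L x' + \<gamma> *\<^sub>R L (P (Ladj (v' - v)))"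
      by (simp add: L.add L.scale)
    have "\<tau> / \<gamma> * \<phi> v' + inv U (v + (\<tau> / \<gamma>) *\<^sub>R U (L p) - v') \<bullet> (w - v') \<le> \<tau> / \<gamma> * \<phi> w"
      unfolding v' by (rule dual_prox_variational(2)[OF w])
    then have "\<gamma> / \<tau> * (\<tau> / \<gamma> * \<phi> v' + inv U (v + (\<tau> / \<gamma>) *\<^sub>R U (L p) - v') \<bullet> (w - v'))
        \<le> \<gamma> / \<tau> * (\<tau> / \<gamma> * \<phi> w)"
      using pos by (intro mult_left_mono) auto
    then have "\<phi> v' - \<phi> w \<le> \<gamma> / \<tau> * (inv U (v + (\<tau> / \<gamma>) *\<^sub>R U (L p) - v') \<bullet> (v' - w))"
      using pos by (simp add: inner_diff_right algebra_simps)
    also have "inv U (v + (\<tau> / \<gamma>) *\<^sub>R U (L p) - v') = inv U (v - v') + (\<tau> / \<gamma>) *\<^sub>R L p"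
      by (simp add: Ui.add Ui.diff Ui.scale inv_U_U)
    also have "\<gamma> / \<tau> * ((inv U (v - v') + (\<tau> / \<gamma>) *\<^sub>R L p) \<bullet> (v' - w))
        = \<gamma> * (precond U L V \<tau> (v - v') \<bullet> (v' - w)) + L x' \<bullet> (v' - w)"
    proof -
      have "L (P (Ladj (v' - v))) = - L (P (Ladj (v - v')))"
        by (simp add: L.diff P.diff Ladj.diff)
      then show ?thesis unfolding precond_eq[OF pos(2)] Lp
        using pos by (simp add: inner_add_left inner_diff_left field_simps)
    qed
    finally have "2 * \<gamma> * (\<phi> v' - \<phi> w)
        \<le> 2 * \<gamma> * (\<gamma> * (precond U L V \<tau> (v - v') \<bullet> (v' - w)) + L x' \<bullet> (v' - w))"
      using pos by (intro mult_left_mono) auto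
    also have "\<dots> = \<gamma>\<^sup>2 * (2 * (precond U L V \<tau> (v - v') \<bullet> (v' - w))) + 2 * \<gamma> * (L x' \<bullet> (v' - w))"
      by (simp add: power2_eq_square algebra_simps)
    also have "\<dots> = \<gamma>\<^sup>2 * (form \<tau> (v - w) - form \<tau> (v' - w)) - \<gamma>\<^sup>2 * form \<tau> (v - v')
        + 2 * \<gamma> * (L x' \<bullet> (v' - w))"
      unfolding form_polarization[OF pos(2)] by (simp add: algebra_simps)
    finally have "2 * \<gamma> * (\<phi> v' - \<phi> w)
      \<le> \<gamma>\<^sup>2 * (form \<tau> (v - w) - form \<tau> (v' - w)) - \<gamma>\<^sup>2 * form \<tau> (v - v')
        + 2 * \<gamma> * (L x' \<bullet> (v' - w))" .
    moreover have "0 \<le> \<gamma>\<^sup>2 * form \<tau> (v - v')"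
      using W unfolding pos_semidef_def wnorm2_def by simp
    ultimately show ?thesis by linarith
  qed

  have "2 * \<gamma> * gap z w x' v'
      = 2 * \<gamma> * (h x' - h z) + 2 * \<gamma> * (\<phi> v' - \<phi> w) + 2 * \<gamma> * (L x' \<bullet> w - L z \<bullet> v')"
    unfolding gap_def by (simp add: algebra_simps)
  also have "L x' \<bullet> w - L z \<bullet> v' = (Ladj v' + s) \<bullet> (x' - z) - s \<bullet> (x' - z) - L x' \<bullet> (v' - w)"
    using adjoint_inner[OF L, of "x' - z" v']
    by (simp add: L.diff inner_diff inner_add inner_commute)
  finally show ?thesis
    using smooth dual primal by (simp add: inner_diff_left algebra_simps)
qed

text \<open>With \<open>e = s - s'\<close> and \<open>d\<close> the resulting change of the dual iterate, the change of
  the primal iterate is \<open>- \<gamma> P (L\<^sup>* d + e)\<close>. The noise shifts the argument of the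
  proximity operator by \<open>- (\<tau>/\<gamma>) U L (\<gamma> P e)\<close>, hence firm nonexpansiveness gives
  \<open>L P e \<bullet> d \<le> 0\<close>: the feedback of the noise through the dual variable has the favourable
  sign, and only the direct term \<open>\<gamma> \<parallel>P e\<parallel>\<^sup>2\<close> remains.\<close>

lemma noise_propagation:
  "- \<gamma> * (norm (s - s'))\<^sup>2 \<le> (s - s') \<bullet> (primal_step \<gamma> \<tau> s x v - primal_step \<gamma> \<tau> s' x v)"
proof -
  let ?e = "s - s'"
  define y where "y s = v + (\<tau> / \<gamma>) *\<^sub>R U (L (P (x - \<gamma> *\<^sub>R (Ladj v + s))))" for s
  define d where "d = dual_step \<gamma> \<tau> s x v - dual_step \<gamma> \<tau> s' x v"
  have "inv U (y s - y s') = - (\<tau> *\<^sub>R L (P ?e))"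
    unfolding y_def using pos
    by (simp add: Ui.diff Ui.add Ui.scale inv_U_U L.add L.diff L.scale P.diff P.add P.scale U.diff U.scale
        algebra_simps)
  moreover have "inv U d \<bullet> d \<le> inv U (y s - y s') \<bullet> d"
    unfolding d_def dual_step_def y_def dual_prox_def
    by (rule prox_conjugate_firmly_nonexpansive[OF g inverse_coercive(2-4)[OF U]]) (use pos in simp)
  ultimately have "\<tau> * (L (P ?e) \<bullet> d) \<le> 0" using inv_U_nonneg[of d] by simp
  then have Ld: "L (P ?e) \<bullet> d \<le> 0" using pos by (simp add: mult_le_0_iff)
  have "primal_step \<gamma> \<tau> s x v - primal_step \<gamma> \<tau> s' x v = - (\<gamma> *\<^sub>R P (Ladj d + ?e))"
    unfolding primal_step_def d_def
    by (simp add: P.diff P.add P.scale Ladj.diff algebra_simps)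
  then have eq: "?e \<bullet> (primal_step \<gamma> \<tau> s x v - primal_step \<gamma> \<tau> s' x v)
      = - \<gamma> * (P ?e \<bullet> Ladj d + (norm (P ?e))\<^sup>2)"
    using P_inner(2)[of ?e "Ladj d + ?e"] P_inner(1)[of ?e "Ladj d + ?e"] P_inner(1)[of ?e ?e]
    by (simp add: inner_add_right power2_norm_eq_inner)
  have "P ?e \<bullet> Ladj d \<le> 0" using Ld by (simp add: adjoint_inner[OF L])
  moreover have "(norm (P ?e))\<^sup>2 \<le> (norm ?e)\<^sup>2"
  proof -
    have "(norm ?e)\<^sup>2 = (norm (P ?e))\<^sup>2 + (norm (?e - P ?e))\<^sup>2"
      using P_inner(1)[of ?e ?e]
      by (simp add: power2_norm_eq_inner inner_diff inner_commute)
    then show ?thesis by simp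
  qed
  ultimately have "P ?e \<bullet> Ladj d + (norm (P ?e))\<^sup>2 \<le> (norm ?e)\<^sup>2" by linarith
  then have "\<gamma> * (P ?e \<bullet> Ladj d + (norm (P ?e))\<^sup>2) \<le> \<gamma> * (norm ?e)\<^sup>2"
    using pos by (intro mult_left_mono) auto
  with eq show ?thesis by linarith
qed

lemma dual_prox_lipschitz:
  obtains B where "B-lipschitz_on UNIV (dual_prox (\<tau> / \<gamma>))"
  unfolding dual_prox_def
  using pos prox_conjugate_lipschitz[OF g inverse_coercive(2-4)[OF U], of "\<tau> / \<gamma>"] by auto

lemma primal_step_borel_measurable:
  assumes [measurable]: "S \<in> borel_measurable F" "X \<in> borel_measurable F" "Y \<in> borel_measurable F"
  shows "(\<lambda>\<omega>. primal_step \<gamma> \<tau> (S \<omega>) (X \<omega>) (Y \<omega>)) \<in> borel_measurable F"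
proof -
  have [measurable]: "dual_prox (\<tau> / \<gamma>) \<in> borel_measurable borel"
    by (rule dual_prox_lipschitz)
      (intro borel_measurable_continuous_onI lipschitz_on_continuous_on)
  have [measurable]: "L \<in> borel_measurable borel" "U \<in> borel_measurable borel"
      "P \<in> borel_measurable borel" "Ladj \<in> borel_measurable borel"
    by (intro borel_measurable_continuous_onI linear_continuous_on L U
        P.bounded_linear_axioms Ladj.bounded_linear_axioms)+
  show ?thesis unfolding primal_step_def dual_step_def by measurable
qed

lemma steps_square_integrable:
  assumes M: "finite_measure M"
    and sq: "square_integrable M S" "square_integrable M X" "square_integrable M Y"
  shows "square_integrable M (\<lambda>\<omega>. dual_step \<gamma> \<tau> (S \<omega>) (X \<omega>) (Y \<omega>))"
    and "square_integrable M (\<lambda>\<omega>. primal_step \<gamma> \<tau> (S \<omega>) (X \<omega>) (Y \<omega>))"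
proof -
  note lin = square_integrable_bounded_linear[OF M]
  note rules = sq lin[OF _ L] lin[OF _ P.bounded_linear_axioms] lin[OF _ U(1)]
    lin[OF _ Ladj.bounded_linear_axioms] square_integrable_add square_integrable_diff[OF M]
    square_integrable_scaleR[OF M]
  obtain B where B: "B-lipschitz_on UNIV (dual_prox (\<tau> / \<gamma>))" by (rule dual_prox_lipschitz)
  show *: "square_integrable M (\<lambda>\<omega>. dual_step \<gamma> \<tau> (S \<omega>) (X \<omega>) (Y \<omega>))"
    unfolding dual_step_def by (rule square_integrable_lipschitz[OF M _ B]) (intro rules)
  show "square_integrable M (\<lambda>\<omega>. primal_step \<gamma> \<tau> (S \<omega>) (X \<omega>) (Y \<omega>))"
    unfolding primal_step_def by (intro rules *)
qed

end

end

section \<open>Ergodic convergence of the expected gap\<close>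

theorem theorem4p3:
  fixes M :: "'w measure"
    and h :: "'a::{real_inner, banach, second_countable_topology} \<Rightarrow> real"
    and g :: "'b::{real_inner, banach, second_countable_topology} \<Rightarrow> ereal"
    and L :: "'a \<Rightarrow> 'b"
    and V :: "'a set"
    and U :: "'b \<Rightarrow> 'b"
    and \<beta> \<tau>bar c0 :: real
    and \<gamma> \<tau> :: "nat \<Rightarrow> real"
    and r x p :: "nat \<Rightarrow> 'w \<Rightarrow> 'a"
    and v :: "nat \<Rightarrow> 'w \<Rightarrow> 'b"
    and xx :: 'a and vv :: 'b
    and N :: nat
  assumes "prob_space M"
    and "\<beta> > 0"
    and "convex_on UNIV h" and "\<forall>y. h differentiable (at y)"
    and "(inverse \<beta>)-lipschitz_on UNIV (gradient h)"
    and "g \<in> Gamma0"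
    and "bounded_linear L"
    and "subspace V" and "closed V"
    and "primal_solutions h g L V \<noteq> {}"
    and "decseq \<gamma>" and "\<forall>n. \<gamma> n > 0"
    and "incseq \<tau>" and "\<forall>n. \<tau> n > 0"
    and "bounded_linear U" and "self_adjoint U" and "pos_def U"
    and "\<forall>n. square_integrable M (r n)"
    and "square_integrable M (x 0)" and "\<forall>\<omega>\<in>space M. x 0 \<omega> \<in> V"
    and "square_integrable M (v 0)"
    and "\<forall>n. \<forall>\<omega>\<in>space M.
           p n \<omega> = orth_proj V (x n \<omega> - \<gamma> n *\<^sub>R (adjoint L (v n \<omega>) + r n \<omega>))"
    and "\<forall>n. \<forall>\<omega>\<in>space M.
           v (Suc n) \<omega> = prox (inv U) (\<lambda>y. ereal (\<tau> n / \<gamma> n) * conjugate g y)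
                           (v n \<omega> + (\<tau> n / \<gamma> n) *\<^sub>R U (L (p n \<omega>)))"
    and "\<forall>n. \<forall>\<omega>\<in>space M.
           x (Suc n) \<omega> = orth_proj V (x n \<omega> - \<gamma> n *\<^sub>R (adjoint L (v (Suc n) \<omega>) + r n \<omega>))"
    and "\<gamma> 0 < \<beta>"
    and "\<tau>bar > 0" and "\<forall>n. \<tau> n \<le> \<tau>bar" and "pos_semidef (precond U L V \<tau>bar)"
    and "\<forall>n. is_cond_exp M (gen_sigma M (\<lambda>k \<omega>. (x k \<omega>, v k \<omega>)) n)
               (r n) (\<lambda>\<omega>. gradient h (x n \<omega>))"
    and "(\<lambda>n. (\<gamma> n)\<^sup>2 * (LINT \<omega>|M. (norm (r n \<omega> - gradient h (x n \<omega>)))\<^sup>2)) sums c0"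
    and "xx \<in> V" and "vv \<in> edom (conjugate g)"
  defines "c \<equiv> (LINT \<omega>|M. (norm (x 0 \<omega> - xx))\<^sup>2
                   + (\<gamma> 0)\<^sup>2 * wnorm2 (precond U L V (\<tau> 0)) (v 0 \<omega> - vv))
               + 2 * (sqrt (\<tau>bar * \<gamma> 0 * onorm U) * (onorm L)\<^sup>2 + 1) * c0"
    and "D \<equiv> (\<lambda>\<omega>. lagr h g L V (erg_avg \<gamma> x N \<omega>) vv - lagr h g L V xx (erg_avg \<gamma> v N \<omega>))"
  shows "(\<forall>\<omega>\<in>space M. \<bar>D \<omega>\<bar> \<noteq> \<infinity>)
       \<and> integrable M (\<lambda>\<omega>. real_of_ereal (D \<omega>))
       \<and> (LINT \<omega>|M. real_of_ereal (D \<omega>)) \<le> c / 2 * inverse (\<Sum>n\<le>N. \<gamma> n)"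
proof -
  interpret prob_space M by fact
  have M: "finite_measure M" by (rule finite_measure_axioms)
  interpret pd: primal_dual h g L V U "inverse \<beta>"
  proof (rule primal_dual.intro)
    show "edom (conjugate g) \<noteq> {}" using assms(32) by blast
  qed (fact assms)+
  have \<gamma>: "\<gamma> n > 0" and \<tau>: "\<tau> n > 0" for n using assms(12,14) by auto
  let ?e = "\<lambda>n \<omega>. r n \<omega> - gradient h (x n \<omega>)"

  have v_step: "v (Suc n) \<omega> = pd.dual_step (\<gamma> n) (\<tau> n) (r n \<omega>) (x n \<omega>) (v n \<omega>)"
    if "\<omega> \<in> space M" for n \<omega>
    using assms(22,23) that unfolding pd.dual_step_def pd.dual_prox_def by simp
  have x_step: "x (Suc n) \<omega> = pd.primal_step (\<gamma> n) (\<tau> n) (r n \<omega>) (x n \<omega>) (v n \<omega>)"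
    if "\<omega> \<in> space M" for n \<omega>
    using assms(24) that v_step[OF that] unfolding pd.primal_step_def by simp
  have x_V: "x n \<omega> \<in> V" if "\<omega> \<in> space M" for n \<omega>
    using assms(20) that x_step[OF that] pd.primal_step_in_V[OF \<gamma> \<tau>] by (cases n) auto
  have v_dom: "v (Suc n) \<omega> \<in> edom (conjugate g)" if "\<omega> \<in> space M" for n \<omega>
    unfolding v_step[OF that] by (rule pd.dual_step_in_edom[OF \<gamma> \<tau>])
  have r_sq: "square_integrable M (r n)" for n using assms(18) by simp
  have sq: "square_integrable M (x n) \<and> square_integrable M (v n)" for n
  proof (induction n)
    case 0 then show ?case using assms(19,21) by simp
  next
    case (Suc n)
    note step = pd.steps_square_integrable[OF \<gamma> \<tau> M r_sq conjunct1[OF Suc] conjunct2[OF Suc]]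
    have "square_integrable M (v (Suc n))"
      using step(1) by (subst square_integrable_cong[OF v_step]) auto
    moreover have "square_integrable M (x (Suc n))"
      using step(2) by (subst square_integrable_cong[OF x_step]) auto
    ultimately show ?case by blast
  qed
  then have x_sq: "square_integrable M (x n)" and v_sq: "square_integrable M (v n)" for n by auto
  have grad_sq: "square_integrable M (\<lambda>\<omega>. gradient h (x n \<omega>))" for n
    by (rule square_integrable_lipschitz[OF M x_sq pd.h(3)])
  have e_sq: "square_integrable M (?e n)" for n
    by (rule square_integrable_diff[OF M r_sq grad_sq])
  note const_sq = square_integrable_const[OF M]

  define \<epsilon> where "\<epsilon> n \<omega> = ?e n \<omega> \<bullet> (x (Suc n) \<omega> - xx)" for n \<omega>
  have \<epsilon>_int: "integrable M (\<epsilon> n)" for n unfolding \<epsilon>_def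
    by (intro square_integrable_inner e_sq square_integrable_diff[OF M] x_sq const_sq)
  have \<epsilon>_lower: "- \<gamma> n * (LINT \<omega>|M. (norm (?e n \<omega>))\<^sup>2) \<le> (LINT \<omega>|M. \<epsilon> n \<omega>)" for n
  proof -
    let ?F = "gen_sigma M (\<lambda>k \<omega>. (x k \<omega>, v k \<omega>)) n"
    \<comment> \<open>The noiseless step is a function of the past, hence orthogonal to the noise.\<close>
    define y where "y \<omega> = pd.primal_step (\<gamma> n) (\<tau> n) (gradient h (x n \<omega>)) (x n \<omega>) (v n \<omega>)" for \<omega>
    have ce: "is_cond_exp M ?F (r n) (\<lambda>\<omega>. gradient h (x n \<omega>))" using assms(29) by blast
    have y_sq: "square_integrable M y" unfolding y_def
      by (intro pd.steps_square_integrable[OF \<gamma> \<tau> M] grad_sq x_sq v_sq)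
    have [measurable]: "gradient h \<in> borel_measurable borel"
      by (intro borel_measurable_continuous_onI lipschitz_on_continuous_on[OF pd.h(3)])
    note [measurable] = gen_sigma_component_measurable[where X = x and Y = v and n = n and M = M]
    have y_meas: "y \<in> borel_measurable ?F" unfolding y_def
      by (intro pd.primal_step_borel_measurable[OF \<gamma> \<tau>]) measurable
    have ortho: "(LINT \<omega>|M. ?e n \<omega> \<bullet> (y \<omega> - xx)) = 0"
      by (intro cond_exp_error_orthogonal[OF M ce r_sq grad_sq] square_integrable_diff[OF M]
          y_sq const_sq borel_measurable_diff y_meas borel_measurable_const)
    have int: "integrable M (\<lambda>\<omega>. ?e n \<omega> \<bullet> (y \<omega> - xx))"
      by (intro square_integrable_inner e_sq square_integrable_diff[OF M] y_sq const_sq)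
    have e2: "integrable M (\<lambda>\<omega>. (norm (?e n \<omega>))\<^sup>2)"
      using e_sq unfolding square_integrable_def by blast
    have "- \<gamma> n * (LINT \<omega>|M. (norm (?e n \<omega>))\<^sup>2)
        = (LINT \<omega>|M. - \<gamma> n * (norm (?e n \<omega>))\<^sup>2 + ?e n \<omega> \<bullet> (y \<omega> - xx))"
      using int e2 ortho by (subst Bochner_Integration.integral_add) auto
    also have "\<dots> \<le> (LINT \<omega>|M. \<epsilon> n \<omega>)"
    proof (rule integral_mono)
      show "integrable M (\<lambda>\<omega>. - \<gamma> n * (norm (?e n \<omega>))\<^sup>2 + ?e n \<omega> \<bullet> (y \<omega> - xx))"
        using int e2 by auto
      fix \<omega> assume \<omega>: "\<omega> \<in> space M"
      have "?e n \<omega> \<bullet> (x (Suc n) \<omega> - xx) = ?e n \<omega> \<bullet> (x (Suc n) \<omega> - y \<omega>) + ?e n \<omega> \<bullet> (y \<omega> - xx)"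
        by (simp add: inner_diff_right)
      then show "- \<gamma> n * (norm (?e n \<omega>))\<^sup>2 + ?e n \<omega> \<bullet> (y \<omega> - xx) \<le> \<epsilon> n \<omega>"
        using pd.noise_propagation[OF \<gamma>[of n] \<tau>[of n], of "r n \<omega>" "gradient h (x n \<omega>)" "x n \<omega>" "v n \<omega>"]
        unfolding \<epsilon>_def y_def x_step[OF \<omega>] by linarith
    qed (rule \<epsilon>_int)
    finally show ?thesis .
  qed

  define \<Phi> where "\<Phi> n \<omega> = (norm (x n \<omega> - xx))\<^sup>2 + (\<gamma> n)\<^sup>2 * pd.form (\<tau> n) (v n \<omega> - vv)" for n \<omega>
  have psd: "0 \<le> pd.form (\<tau> n) y" for n y
  proof -
    have "0 \<le> pd.form \<tau>bar y" using assms(28) unfolding pos_semidef_def wnorm2_def by simp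
    also have "\<dots> \<le> pd.form (\<tau> n) y" using assms(27) by (intro pd.form_antimono \<tau>) auto
    finally show ?thesis .
  qed
  have \<Phi>_nonneg: "0 \<le> \<Phi> n \<omega>" for n \<omega> unfolding \<Phi>_def using psd by simp
  have decrease: "2 * \<gamma> n * pd.gap xx vv (x (Suc n) \<omega>) (v (Suc n) \<omega>)
      \<le> (\<Phi> n \<omega> - \<Phi> (Suc n) \<omega>) - 2 * \<gamma> n * \<epsilon> n \<omega>" if \<omega>: "\<omega> \<in> space M" for n \<omega>
  proof -
    have "\<gamma> n \<le> \<gamma> 0" using assms(11) by (simp add: decseq_def)
    then have K: "inverse \<beta> * \<gamma> n \<le> 1" using assms(2,25) by (simp add: field_simps)
    have W: "pos_semidef (precond U L V (\<tau> n))"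
      using psd[of n] unfolding pos_semidef_def wnorm2_def by simp
    \<comment> \<open>Here the monotonicity of both step-size sequences enters: the scaled metric
      weakens from one iteration to the next.\<close>
    have "(\<gamma> (Suc n))\<^sup>2 * pd.form (\<tau> (Suc n)) (v (Suc n) \<omega> - vv)
        \<le> (\<gamma> n)\<^sup>2 * pd.form (\<tau> n) (v (Suc n) \<omega> - vv)"
    proof (rule mult_mono)
      show "(\<gamma> (Suc n))\<^sup>2 \<le> (\<gamma> n)\<^sup>2"
        using assms(11) \<gamma> by (intro power_mono decseq_SucD) (auto intro: less_imp_le)
      show "pd.form (\<tau> (Suc n)) (v (Suc n) \<omega> - vv) \<le> pd.form (\<tau> n) (v (Suc n) \<omega> - vv)"
        by (intro pd.form_antimono \<tau> incseq_SucD assms(13))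
    qed (auto simp: psd)
    moreover note pd.gap_decrease[OF \<gamma>[of n] \<tau>[of n] K W x_V[OF \<omega>, of n] assms(31,32),
        where s = "r n \<omega>" and v = "v n \<omega>",
        folded x_step[OF \<omega>] v_step[OF \<omega>]]
    ultimately show ?thesis unfolding \<Phi>_def \<epsilon>_def by (simp add: algebra_simps)
  qed

  define \<Gamma> where "\<Gamma> = (\<Sum>n\<le>N. \<gamma> n)"
  have \<Gamma>: "\<Gamma> > 0" unfolding \<Gamma>_def by (intro sum_pos \<gamma>) auto
  define a where "a n = \<gamma> n / \<Gamma>" for n
  have a_sum: "(\<Sum>n\<le>N. a n) = 1"
    using \<Gamma> unfolding a_def sum_divide_distrib[symmetric] \<Gamma>_def[symmetric] by simp
  have a_nonneg: "0 \<le> a n" for n unfolding a_def using \<Gamma> \<gamma>[of n] by simp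
  have avg_x: "erg_avg \<gamma> x N \<omega> = (\<Sum>n\<le>N. a n *\<^sub>R x (Suc n) \<omega>)" for \<omega>
    unfolding erg_avg_def a_def \<Gamma>_def[symmetric]
    by (simp add: scaleR_sum_right divide_inverse mult.commute)
  have avg_v: "erg_avg \<gamma> v N \<omega> = (\<Sum>n\<le>N. a n *\<^sub>R v (Suc n) \<omega>)" for \<omega>
    unfolding erg_avg_def a_def \<Gamma>_def[symmetric]
    by (simp add: scaleR_sum_right divide_inverse mult.commute)
  have avg_V: "erg_avg \<gamma> x N \<omega> \<in> V" if "\<omega> \<in> space M" for \<omega>
    unfolding avg_x using x_V[OF that] by (intro subspace_sum subspace_scale pd.V) auto
  have avg_dom: "erg_avg \<gamma> v N \<omega> \<in> edom (conjugate g)" if "\<omega> \<in> space M" for \<omega>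
    unfolding avg_v
    using conjugate_convex_on[OF pd.g(1)] a_sum a_nonneg v_dom[OF that]
    by (intro convex_sum) (auto simp: convex_on_def)
  have avg_sq: "square_integrable M (erg_avg \<gamma> x N)" "square_integrable M (erg_avg \<gamma> v N)"
    unfolding avg_x[abs_def] avg_v[abs_def]
    by (intro square_integrable_sum[OF M] square_integrable_scaleR[OF M] x_sq v_sq)+

  define G where "G \<omega> = pd.gap xx vv (erg_avg \<gamma> x N \<omega>) (erg_avg \<gamma> v N \<omega>)" for \<omega>
  have D: "D \<omega> = ereal (G \<omega>)" if "\<omega> \<in> space M" for \<omega>
    unfolding D_def G_def
    by (rule pd.lagr_difference[OF avg_V[OF that] assms(31) avg_dom[OF that] assms(32)])
  define R where "R \<omega> = \<Phi> 0 \<omega> - (\<Sum>n\<le>N. 2 * \<gamma> n * \<epsilon> n \<omega>)" for \<omega>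
  have upper: "G \<omega> \<le> R \<omega> / (2 * \<Gamma>)" if \<omega>: "\<omega> \<in> space M" for \<omega>
  proof -
    have "G \<omega> \<le> (\<Sum>n\<le>N. a n * pd.gap xx vv (x (Suc n) \<omega>) (v (Suc n) \<omega>))"
      unfolding G_def avg_x avg_v by (rule pd.gap_jensen) (auto simp: a_sum a_nonneg v_dom[OF \<omega>])
    also have "\<dots> = (\<Sum>n\<le>N. 2 * \<gamma> n * pd.gap xx vv (x (Suc n) \<omega>) (v (Suc n) \<omega>)) / (2 * \<Gamma>)"
      unfolding sum_divide_distrib a_def by (intro sum.cong) (auto simp: field_simps)
    also have "\<dots> \<le> (\<Sum>n\<le>N. (\<Phi> n \<omega> - \<Phi> (Suc n) \<omega>) - 2 * \<gamma> n * \<epsilon> n \<omega>) / (2 * \<Gamma>)"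
      using \<Gamma> by (intro divide_right_mono sum_mono decrease \<omega>) auto
    also have "(\<Sum>n\<le>N. (\<Phi> n \<omega> - \<Phi> (Suc n) \<omega>) - 2 * \<gamma> n * \<epsilon> n \<omega>) = R \<omega> - \<Phi> (Suc N) \<omega>"
      unfolding R_def sum_subtractf[of "\<lambda>n. \<Phi> n \<omega> - \<Phi> (Suc n) \<omega>"]
        sum_telescope[of "\<lambda>n. \<Phi> n \<omega>" N] by simp
    also have "(R \<omega> - \<Phi> (Suc N) \<omega>) / (2 * \<Gamma>) \<le> R \<omega> / (2 * \<Gamma>)"
      using \<Gamma> \<Phi>_nonneg by (intro divide_right_mono) auto
    finally show ?thesis .
  qed

  have \<Phi>0_int: "integrable M (\<Phi> 0)"
  proof -
    have d_sq: "square_integrable M (\<lambda>\<omega>. x 0 \<omega> - xx)" "square_integrable M (\<lambda>\<omega>. v 0 \<omega> - vv)"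
      by (intro square_integrable_diff[OF M] x_sq v_sq const_sq)+
    have "integrable M (\<lambda>\<omega>. pd.form (\<tau> 0) (v 0 \<omega> - vv))" unfolding wnorm2_def
      by (intro square_integrable_inner d_sq
          square_integrable_bounded_linear[OF M _ pd.bounded_linear_precond[OF \<tau>]])
    then show ?thesis
      using d_sq(1) unfolding \<Phi>_def[abs_def] square_integrable_def by auto
  qed
  have R_int: "integrable M R" unfolding R_def[abs_def]
    using \<Phi>0_int \<epsilon>_int by auto
  have G_int: "integrable M G"
  proof -
    obtain b b' d where lower: "\<And>x v. v \<in> edom (conjugate g) \<Longrightarrow> x \<bullet> b + v \<bullet> b' + d \<le> pd.gap xx vv x v"
      using pd.gap_affine_minorant by blast
    let ?l = "\<lambda>\<omega>. erg_avg \<gamma> x N \<omega> \<bullet> b + erg_avg \<gamma> v N \<omega> \<bullet> b' + d"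
    have l_int: "integrable M ?l"
      using square_integrable_inner[OF avg_sq(1) const_sq] square_integrable_inner[OF avg_sq(2) const_sq]
      by auto
    show ?thesis
    proof (rule Bochner_Integration.integrable_bound)
      show "integrable M (\<lambda>\<omega>. \<bar>?l \<omega>\<bar> + \<bar>R \<omega> / (2 * \<Gamma>)\<bar>)"
        using l_int R_int by auto
      show "G \<in> borel_measurable M"
        using avg_sq unfolding G_def[abs_def] square_integrable_def
        by (intro pd.gap_borel_measurable) auto
      show "AE \<omega> in M. norm (G \<omega>) \<le> norm (\<bar>?l \<omega>\<bar> + \<bar>R \<omega> / (2 * \<Gamma>)\<bar>)"
      proof (rule AE_I2)
        fix \<omega> assume \<omega>: "\<omega> \<in> space M"
        have "?l \<omega> \<le> G \<omega>" unfolding G_def by (rule lower[OF avg_dom[OF \<omega>]])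
        then show "norm (G \<omega>) \<le> norm (\<bar>?l \<omega>\<bar> + \<bar>R \<omega> / (2 * \<Gamma>)\<bar>)"
          using upper[OF \<omega>] unfolding real_norm_def by linarith
      qed
    qed
  qed

  have c0_partial: "(\<Sum>n\<le>N. (\<gamma> n)\<^sup>2 * (LINT \<omega>|M. (norm (?e n \<omega>))\<^sup>2)) \<le> c0"
    using sum_le_suminf[OF sums_summable[OF assms(30)], of "{..N}"] sums_unique[OF assms(30)]
    by simp
  have c0: "0 \<le> c0"
    by (rule order_trans[OF sum_nonneg c0_partial]) simp
  have R_bound: "(LINT \<omega>|M. R \<omega>) \<le> c"
  proof -
    have "(\<Sum>n\<le>N. 2 * \<gamma> n * (- \<gamma> n * (LINT \<omega>|M. (norm (?e n \<omega>))\<^sup>2)))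
        \<le> (\<Sum>n\<le>N. 2 * \<gamma> n * (LINT \<omega>|M. \<epsilon> n \<omega>))"
      using \<gamma> by (intro sum_mono mult_left_mono \<epsilon>_lower) (auto intro: less_imp_le)
    then have noise: "- (\<Sum>n\<le>N. 2 * \<gamma> n * (LINT \<omega>|M. \<epsilon> n \<omega>))
        \<le> 2 * (\<Sum>n\<le>N. (\<gamma> n)\<^sup>2 * (LINT \<omega>|M. (norm (?e n \<omega>))\<^sup>2))"
      by (simp add: sum_negf sum_distrib_left power2_eq_square mult.assoc)
    have "(LINT \<omega>|M. R \<omega>) = (LINT \<omega>|M. \<Phi> 0 \<omega>) - (\<Sum>n\<le>N. 2 * \<gamma> n * (LINT \<omega>|M. \<epsilon> n \<omega>))"
      unfolding R_def using \<Phi>0_int \<epsilon>_int by simp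
    also have "\<dots> \<le> (LINT \<omega>|M. \<Phi> 0 \<omega>)
        + 2 * (\<Sum>n\<le>N. (\<gamma> n)\<^sup>2 * (LINT \<omega>|M. (norm (?e n \<omega>))\<^sup>2))"
      using noise by linarith
    also have "\<dots> \<le> (LINT \<omega>|M. \<Phi> 0 \<omega>) + 2 * (1 * c0)"
      using c0_partial by simp
    \<comment> \<open>The noise contributes \<open>2 * c0\<close>, and the factor of \<open>2 * c0\<close> in \<open>c\<close> is at least one.\<close>
    also have "\<dots> \<le> (LINT \<omega>|M. \<Phi> 0 \<omega>) + 2 * ((sqrt (\<tau>bar * \<gamma> 0 * onorm U) * (onorm L)\<^sup>2 + 1) * c0)"
      using assms(26) \<gamma>[of 0] c0 onorm_pos_le[OF pd.U(1)]
      by (intro add_left_mono mult_left_mono mult_right_mono) auto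
    also have "\<dots> = c" unfolding c_def \<Phi>_def mult.assoc ..
    finally show ?thesis .
  qed

  have "(LINT \<omega>|M. G \<omega>) \<le> (LINT \<omega>|M. R \<omega> / (2 * \<Gamma>))"
    using R_int by (intro integral_mono G_int upper) auto
  also have "\<dots> \<le> c / (2 * \<Gamma>)"
    using R_bound \<Gamma> by (simp add: divide_right_mono)
  also have "\<dots> = c / 2 * inverse \<Gamma>"
    by (simp only: divide_inverse inverse_mult_distrib mult.assoc)
  finally have bound: "(LINT \<omega>|M. G \<omega>) \<le> c / 2 * inverse (\<Sum>n\<le>N. \<gamma> n)" unfolding \<Gamma>_def .
  have "integrable M (\<lambda>\<omega>. real_of_ereal (D \<omega>)) \<longleftrightarrow> integrable M G"
    "(LINT \<omega>|M. real_of_ereal (D \<omega>)) = (LINT \<omega>|M. G \<omega>)"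
    by (auto intro!: Bochner_Integration.integrable_cong Bochner_Integration.integral_cong simp: D)
  then show ?thesis using D G_int bound by simp
qed

end
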